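(* Let $n\ge 3$ and let $(x_1,y_1),\ldots,(x_n,y_n)$ be points of the open unit disc $\{(x,y)\in\mathbb{R}^2 : x^2+y^2<1\}$ which are the positively oriented (listed counterclockwise along the boundary) vertices of a hyperbolic $n$-gon in the Poincaré disc model, consecutive vertices being distinct. Put $(x_{n+1},y_{n+1})=(x_1,y_1)$. Then the hyperbolic area $A$ of the $n$-gon is $$A=\sum_{k=1}^n 2\,\mathrm{Tan}^{-1}\left(\frac{x_k y_{k+1}-y_k x_{k+1}}{1-x_k x_{k+1}-y_k y_{k+1}}\right).$$
   Context: The Poincaré disc model is the unit disc with the conformal metric $\frac{2}{1-|z|^2}|dz|$. The hyperbolic area of a region $\mathcal{R}$ in the disc is $\iint_{\mathcal{R}}\left(\frac{2}{1-x^2-y^2}\right)^2 dx\,dy$. The geodesic joining two distinct points of the open disc is the unique distance-minimizing curve between them; it is an arc, inside the disc, of a circle meeting the unit circle at right angles (or a Euclidean segment of a diameter). A hyperbolic $n$-gon with vertices $z_1,\ldots,z_n$ is the region bounded by the closed curve consisting of the geodesics from $z_k$ to $z_{k+1}$, $k=1,\ldots,n$ (with $z_{n+1}=z_1$), where this closed curve is assumed to be a Jordan curve. $\mathrm{Tan}^{-1}$ is the principal arctangent, with values in $(-\pi/2,\pi/2)$. *)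

theory Defs
  imports "HOL-Complex_Analysis.Complex_Analysis"
begin

definition poincare_density :: "complex \<Rightarrow> real" where
  "poincare_density z = 2 / (1 - (cmod z)\<^sup>2)"

(* Extended-valued on purpose: valid_path does not bound the derivative near its
   exceptional points, so such a path can have infinite length, which a real-valued
   integral would report as 0. *)
definition hyperbolic_length :: "(real \<Rightarrow> complex) \<Rightarrow> ennreal" where
  "hyperbolic_length g =
     (\<integral>\<^sup>+ t\<in>{0..1}. ennreal (poincare_density (g t) * cmod (vector_derivative g (at t))) \<partial>lborel)"

definition disc_path :: "complex \<Rightarrow> complex \<Rightarrow> (real \<Rightarrow> complex) \<Rightarrow> bool" where
  "disc_path a b g \<longleftrightarrow>
     valid_path g \<and> path_image g \<subseteq> ball 0 1 \<and> pathstart g = a \<and> pathfinish g = b"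

(* Distance-minimizing curves, up to parametrization. *)
definition hyperbolic_geodesic :: "complex \<Rightarrow> complex \<Rightarrow> (real \<Rightarrow> complex) \<Rightarrow> bool" where
  "hyperbolic_geodesic a b g \<longleftrightarrow>
     disc_path a b g \<and> (\<forall>h. disc_path a b h \<longrightarrow> hyperbolic_length g \<le> hyperbolic_length h)"

(* The loop g parametrizes the boundary of the n-gon with vertices z 1, ..., z n; the
   value z (n + 1) is meant to equal z 1. The vertices sit at the parameters t k. *)
definition hyperbolic_polygon_boundary ::
    "nat \<Rightarrow> (nat \<Rightarrow> complex) \<Rightarrow> (real \<Rightarrow> complex) \<Rightarrow> bool" where
  "hyperbolic_polygon_boundary n z g \<longleftrightarrow>
     simple_path g \<and> pathfinish g = pathstart g \<and>
     (\<exists>t. t 1 = 0 \<and> t (n + 1) = 1 \<and> strict_mono_on {1..n + 1} t \<and>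
          (\<forall>k\<in>{1..n}. hyperbolic_geodesic (z k) (z (k + 1)) (subpath (t k) (t (k + 1)) g)))"

(* Counterclockwise: the curve winds once, positively, around every point it encloses. *)
definition positively_oriented :: "(real \<Rightarrow> complex) \<Rightarrow> bool" where
  "positively_oriented g \<longleftrightarrow> (\<forall>w\<in>inside (path_image g). winding_number g w = 1)"

(* For R with closure inside the open disc, as for polygons, the integrand is bounded
   on R, so the integral is a genuine one. *)
definition hyperbolic_area :: "complex set \<Rightarrow> real" where
  "hyperbolic_area R = (LINT z:R|lborel. (poincare_density z)\<^sup>2)"

end

(* The curve winds once around each enclosed point and zero times around the others, so
   the area is the integral of rho^2(w) W(g, w) over a disc |w| < R, where rho is the Poincare
   density and W the winding number. This replaces Green's theorem: writing W as the Cauchy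
   integral of dz / (z - w) and using Fubini, the area becomes a line integral along g of the
   Cauchy transform of rho^2. By rotational symmetry that transform is
   4 pi conj(z) / (1 - |z|^2).

   A distance-minimizing curve lies on the Moebius image of a segment through 0, by the strict
   triangle inequality, and hence has the same winding numbers as this explicit arc. Along the
   arc from a to b the line integral has the primitive Ln (1 + p t), up to a real term, with
   p = conj(a) (b - a) / (1 - conj(a) b); the side contributes
   2 Arg (1 + p) = -2 Arg (1 - conj(a) b). *)
theory Submission
  imports Defs
begin

text \<open>Winding numbers suit a boundary that is known only through the minimality of its sides:
  the parametrization of a side is not fixed, but off the curve winding numbers are homotopy
  invariant and add up over the sides, and the curve itself is a null set. Neither angles
  (Gauss-Bonnet) nor a triangulation enters. Two analytic obstacles shape the rest. The Cauchy
  kernel is singular on the curve, but \<open>1 / cmod (z - w)\<close> is integrable in the plane,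
  which justifies Fubini. The density blows up at the unit circle, but the compact boundary fits
  into a disc of radius \<open>R < 1\<close>, where the density is bounded. The transform is the
  hyperbolic area \<open>4 * pi * r^2 / (1 - r^2)\<close> of the disc of radius
  \<open>r = cmod z\<close>, times \<open>1 / z\<close>. With the factor
  \<open>1 / (2 * pi * \<i>)\<close> of the winding number, \<open>-2 * \<i>\<close> stands before
  each line integral. The area is real, so real parts may be taken: they keep twice the imaginary
  part of the line integral and discard its real terms.\<close>

section \<open>Lebesgue measure on the plane in polar form\<close>

text \<open>Uniqueness of Haar measure: evaluate the double integral of
  \<open>indicator A (x - y) * indicator B y\<close> in both orders, for \<open>B\<close> the unit ball.\<close>
lemma lborel_eqI_translation_invariant:
  fixes M :: "'a::euclidean_space measure"
  assumes sets [measurable_cong]: "sets M = sets borel" and "sigma_finite_measure M"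
    and transl: "\<And>f a. f \<in> borel_measurable borel \<Longrightarrow> (\<integral>\<^sup>+x. f (x - a) \<partial>M) = (\<integral>\<^sup>+x. f x \<partial>M)"
    and ball: "emeasure M (ball 0 1) = emeasure lborel (ball (0::'a) 1)"
  shows "M = lborel"
proof (rule measure_eqI)
  fix A assume "A \<in> sets M"
  then have A [measurable]: "A \<in> sets borel" by (simp add: sets)
  define B where "B = ball (0::'a) 1"
  have B [measurable]: "B \<in> sets borel" by (simp add: B_def)
  interpret M: sigma_finite_measure M by fact
  interpret P: pair_sigma_finite M "lborel :: 'a measure"
    by (simp add: M.sigma_finite_measure_axioms lborel.sigma_finite_measure_axioms pair_sigma_finite_def)
  have lb: "(\<integral>\<^sup>+x. f (y - x) \<partial>lborel) = (\<integral>\<^sup>+x. f x \<partial>lborel)"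
    if [measurable]: "f \<in> borel_measurable borel" for f :: "'a \<Rightarrow> ennreal" and y
  proof -
    have "(\<integral>\<^sup>+x. f x \<partial>lborel) = (\<integral>\<^sup>+x. f x \<partial>(density (distr lborel borel (\<lambda>x. y + (-1) *\<^sub>R x)) (\<lambda>_. ennreal (\<bar>-1\<bar>^DIM('a)))))"
      by (subst lborel_affine[of "-1" y, symmetric]) auto
    also have "\<dots> = (\<integral>\<^sup>+x. f (y - x) \<partial>lborel)"
      by (simp add: nn_integral_density nn_integral_distr)
    finally show ?thesis by simp
  qed
  have "emeasure M A * emeasure lborel B =
        (\<integral>\<^sup>+y. \<integral>\<^sup>+x. indicator A x * indicator B y \<partial>M \<partial>lborel)"
    using \<open>A \<in> sets M\<close> by (simp add: nn_integral_multc nn_integral_cmult)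
  also have "\<dots> = (\<integral>\<^sup>+y. \<integral>\<^sup>+x. indicator A (x - y) * indicator B y \<partial>M \<partial>lborel)"
    by (intro nn_integral_cong transl[symmetric]) simp
  also have "\<dots> = (\<integral>\<^sup>+x. \<integral>\<^sup>+y. indicator A (x - y) * indicator B y \<partial>lborel \<partial>M)"
    by (rule P.Fubini') measurable
  also have "\<dots> = (\<integral>\<^sup>+x. \<integral>\<^sup>+y. indicator A y * indicator B (x - y) \<partial>lborel \<partial>M)"
  proof (rule nn_integral_cong)
    fix x
    show "(\<integral>\<^sup>+y. indicator A (x - y) * indicator B y \<partial>lborel) = (\<integral>\<^sup>+y. indicator A y * indicator B (x - y) \<partial>lborel)"
      using lb[of "\<lambda>y. indicator A (x - y) * indicator B y" x] by simp
  qed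
  also have "\<dots> = (\<integral>\<^sup>+y. \<integral>\<^sup>+x. indicator A y * indicator B (x - y) \<partial>M \<partial>lborel)"
    by (rule P.Fubini'[symmetric]) measurable
  also have "\<dots> = (\<integral>\<^sup>+y. \<integral>\<^sup>+x. indicator A y * indicator B x \<partial>M \<partial>lborel)"
    by (intro nn_integral_cong transl) simp
  also have "\<dots> = emeasure lborel A * emeasure M B"
    by (simp add: nn_integral_multc nn_integral_cmult sets)
  finally have "emeasure M A * emeasure lborel B = emeasure lborel A * emeasure lborel B"
    using ball by (simp add: B_def)
  moreover have "emeasure lborel B \<noteq> 0" "emeasure lborel B \<noteq> top"
    by (simp_all add: B_def emeasure_ball unit_ball_vol_pos less_imp_le ennreal_eq_0_iff not_le)
  ultimately show "emeasure M A = emeasure lborel A"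
    by (metis ennreal_mult_divide_eq)
qed (simp add: sets)

text \<open>Translating by \<open>a\<close> after the rotation is the same as translating by
  \<open>a / e\<close> before it, and balls about 0 are fixed, so uniqueness of Haar measure
  applies.\<close>

lemma lborel_distr_rotation:
  fixes e :: complex
  assumes "cmod e = 1"
  shows "distr lborel borel ((*) e) = (lborel :: complex measure)"
proof (rule lborel_eqI_translation_invariant)
  have e0: "e \<noteq> 0" using assms by auto
  have vim: "(*) e -` ball 0 r = ball 0 r" for r
    using assms by (auto simp: norm_mult)
  show "sigma_finite_measure (distr lborel borel ((*) e))"
  proof
    show "\<exists>A::complex set set. countable A \<and> A \<subseteq> sets (distr lborel borel ((*) e)) \<and> \<Union> A = space (distr lborel borel ((*) e)) \<and>
       (\<forall>a\<in>A. emeasure (distr lborel borel ((*) e)) a \<noteq> \<infinity>)"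
      by (rule exI[of _ "range (\<lambda>n::nat. ball 0 (real n))"])
         (auto simp: emeasure_distr vim emeasure_ball, metis reals_Archimedean2)
  qed
  show "emeasure (distr lborel borel ((*) e)) (ball 0 1) = emeasure lborel (ball (0::complex) 1)"
    by (simp add: emeasure_distr vim)
  fix f :: "complex \<Rightarrow> ennreal" and a assume [measurable]: "f \<in> borel_measurable borel"
  have "(\<integral>\<^sup>+x. f (e * x) \<partial>lborel) = (\<integral>\<^sup>+x. f (e * x) \<partial>distr lborel borel ((+) (-a/e)))"
    by (simp add: lborel_distr_plus)
  also have "\<dots> = (\<integral>\<^sup>+x. f (e * x - a) \<partial>lborel)"
    using e0 by (simp add: nn_integral_distr algebra_simps)
  finally show "(\<integral>\<^sup>+x. f (x - a) \<partial>distr lborel borel ((*) e)) = (\<integral>\<^sup>+x. f x \<partial>distr lborel borel ((*) e))"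
    by (simp add: nn_integral_distr)
qed simp

text \<open>The half-lines \<open>{..a}\<close> generate the Borel sets. Their preimages are discs
  of area \<open>pi * a^2\<close>, whose derivative in the radius is the density
  \<open>2 * pi * s\<close>. This is all of polar coordinates that radial integrands
  require.\<close>

lemma distr_lborel_cmod:
  "distr lborel borel cmod = density lborel (\<lambda>s. ennreal (2 * pi * s) * indicator {0..} s)"
proof (rule measure_eqI_generator_eq)
  let ?E = "range (\<lambda>a::real. {..a})" 
  show "Int_stable ?E"
    by (auto simp: Int_stable_def)
  show "?E \<subseteq> Pow UNIV" by auto
  show "sets (distr lborel borel cmod) = sigma_sets UNIV ?E"
    "sets (density lborel (\<lambda>s. ennreal (2 * pi * s) * indicator {0..} s)) = sigma_sets UNIV ?E"
    by (simp_all add: borel_eq_atMost)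
  have vim: "cmod -` {..a} = cball 0 a" for a by auto
  show "range (\<lambda>n::nat. {..real n}) \<subseteq> ?E" by auto
  show "(\<Union>n::nat. {..real n}) = UNIV" 
    by (auto intro: real_arch_simple)
  show "emeasure (distr lborel borel cmod) {..real n} \<noteq> \<infinity>" for n :: nat
    by (simp add: emeasure_distr vim emeasure_cball)
  fix X assume "X \<in> ?E"
  then obtain a where X: "X = {..a}" by auto
  show "emeasure (distr lborel borel cmod) X =
     emeasure (density lborel (\<lambda>s. ennreal (2 * pi * s) * indicator {0..} s)) X"
  proof (cases "a \<ge> 0")
    case False
    then show ?thesis 
      by (auto simp: X emeasure_distr vim emeasure_density nn_integral_0_iff_AE indicator_def)
  next
    case True
    have "emeasure (density lborel (\<lambda>s. ennreal (2 * pi * s) * indicator {0..} s)) X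
      = (\<integral>\<^sup>+s. ennreal (2 * pi * s) * indicator {0..a} s \<partial>lborel)"
      by (auto simp: X emeasure_density indicator_def intro!: nn_integral_cong)
    also have "\<dots> = pi * a^2 - pi * 0^2"
      by (intro nn_integral_FTC_Icc) (use True in \<open>auto intro!: derivative_eq_intros\<close>)
    also have "\<dots> = emeasure (distr lborel borel cmod) X"
      using True by (simp add: X emeasure_distr vim emeasure_cball unit_ball_vol_2)
    finally show ?thesis ..
  qed
qed

lemma nn_integral_cmod:
  assumes [measurable]: "f \<in> borel_measurable borel"
  shows "(\<integral>\<^sup>+w. f (cmod w) \<partial>lborel) = (\<integral>\<^sup>+s. ennreal (2 * pi * s) * indicator {0..} s * f s \<partial>lborel)"
proof -
  have "(\<integral>\<^sup>+w. f (cmod w) \<partial>lborel) = (\<integral>\<^sup>+s. f s \<partial>distr lborel borel cmod)"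
    by (simp add: nn_integral_distr)
  also have "\<dots> = (\<integral>\<^sup>+s. ennreal (2 * pi * s) * indicator {0..} s * f s \<partial>lborel)"
    by (simp add: distr_lborel_cmod nn_integral_density)
  finally show ?thesis .
qed

section \<open>The Cauchy transform of the hyperbolic area\<close>

text \<open>In polar form about \<open>z\<close> the factor \<open>s\<close> of the Jacobian cancels
  the pole, leaving \<open>2 * pi\<close> per unit of radius. The unit disc lies in the disc of
  radius 2 about \<open>z\<close>, whence \<open>4 * pi\<close>, uniformly in
  \<open>z\<close>.\<close>

lemma nn_integral_inverse_dist_le:
  assumes "cmod z \<le> 1"
  shows "(\<integral>\<^sup>+w. indicator (ball 0 1) w * ennreal (1 / cmod (z - w)) \<partial>lborel) \<le> ennreal (4 * pi)"
proof -
  have "(\<integral>\<^sup>+w. indicator (ball 0 1) w * ennreal (1 / cmod (z - w)) \<partial>lborel)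
      \<le> (\<integral>\<^sup>+w. indicator (ball z 2) w * ennreal (1 / cmod (z - w)) \<partial>lborel)"
  proof (intro nn_integral_mono mult_right_mono)
    fix w
    show "indicator (ball 0 1) w \<le> (indicator (ball z 2) w :: ennreal)"
      using assms norm_triangle_ineq4[of z w] by (auto simp: indicator_def dist_norm)
  qed simp
  also have "\<dots> = (\<integral>\<^sup>+w. indicator (ball z 2) w * ennreal (1 / cmod (z - w)) \<partial>distr lborel borel ((+) z))"
    by (simp add: lborel_distr_plus)
  also have "\<dots> = (\<integral>\<^sup>+u. indicator {..<2} (cmod u) * ennreal (1 / cmod u) \<partial>lborel)"
    by (subst nn_integral_distr) (auto simp: indicator_def dist_norm intro!: nn_integral_cong)
  also have "\<dots> = (\<integral>\<^sup>+s. ennreal (2 * pi * s) * indicator {0..} s * (indicator {..<2} s * ennreal (1 / s)) \<partial>lborel)"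
    by (rule nn_integral_cmod) measurable
  also have "\<dots> \<le> (\<integral>\<^sup>+s. ennreal (2 * pi) * indicator {0..2::real} s \<partial>lborel)"
    by (intro nn_integral_mono) (auto simp: indicator_def ennreal_mult[symmetric])
  also have "\<dots> = ennreal (4 * pi)"
    by (simp add: nn_integral_cmult ennreal_mult[symmetric] flip: ennreal_numeral)
  finally show ?thesis .
qed

lemma poincare_density_pos: "cmod w < 1 \<Longrightarrow> poincare_density w > 0"
  by (simp add: poincare_density_def abs_square_less_1)

lemma poincare_density_mono: "cmod v \<le> cmod w \<Longrightarrow> cmod w < 1 \<Longrightarrow> poincare_density v \<le> poincare_density w"
  by (simp add: poincare_density_def frac_le abs_square_less_1 power_mono)

lemma measurable_poincare_density [measurable]: "poincare_density \<in> borel_measurable borel"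
  unfolding poincare_density_def by measurable

lemma measurable_indicator_density:
  "A \<in> sets borel \<Longrightarrow> (\<lambda>w. indicator A w * (poincare_density w)\<^sup>2) \<in> borel_measurable borel"
  by (intro borel_measurable_times borel_measurable_indicator borel_measurable_power measurable_poincare_density) simp

text \<open>With \<open>r = tanh (\<rho> / 2)\<close>, where \<open>\<rho>\<close> is the hyperbolic
  radius, this is the familiar area \<open>4 * pi * (sinh (\<rho> / 2))^2\<close>. It is the
  enclosed mass in the shell theorem below.\<close>

lemma hyperbolic_disc_area:
  assumes "0 \<le> r" "r < 1"
  shows "has_bochner_integral lborel (\<lambda>w. indicator (cball 0 r) w * (poincare_density w)\<^sup>2) (4 * pi * r\<^sup>2 / (1 - r\<^sup>2))"
proof (rule has_bochner_integral_nn_integral)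
  have r2: "1 - s\<^sup>2 > 0" if "0 \<le> s" "s \<le> r" for s
    using that assms by (simp add: abs_square_less_1)
  show "0 \<le> 4 * pi * r\<^sup>2 / (1 - r\<^sup>2)" using r2[of r] assms by simp
  have "(\<integral>\<^sup>+w. ennreal (indicator (cball 0 r) w * (poincare_density w)\<^sup>2) \<partial>lborel)
    = (\<integral>\<^sup>+w. indicator {..r} (cmod w) * ennreal ((2 / (1 - (cmod w)\<^sup>2))\<^sup>2) \<partial>lborel)"
    by (intro nn_integral_cong) (auto simp: indicator_def poincare_density_def)
  also have "\<dots> = (\<integral>\<^sup>+s. ennreal (2 * pi * s) * indicator {0..} s * (indicator {..r} s * ennreal ((2 / (1 - s\<^sup>2))\<^sup>2)) \<partial>lborel)"
    by (rule nn_integral_cmod) measurable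
  also have "\<dots> = (\<integral>\<^sup>+s. ennreal (2 * pi * s * (2 / (1 - s\<^sup>2))\<^sup>2) * indicator {0..r} s \<partial>lborel)"
    by (intro nn_integral_cong) (auto simp: indicator_def ennreal_mult)
  also have "\<dots> = 4 * pi / (1 - r\<^sup>2) - 4 * pi / (1 - 0\<^sup>2)"
  proof (rule nn_integral_FTC_Icc)
    fix s assume s: "s \<in> {0..r}"
    show "((\<lambda>s. 4 * pi / (1 - s\<^sup>2)) has_real_derivative 2 * pi * s * (2 / (1 - s\<^sup>2))\<^sup>2) (at s)"
    proof -
      have "1 - s\<^sup>2 \<noteq> 0" using r2[of s] s by simp
      then show ?thesis
        by (auto intro!: derivative_eq_intros simp: power_divide power2_eq_square[of "1 - s\<^sup>2"])
    qed
  qed (use assms in auto)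
  also have "4 * pi / (1 - r\<^sup>2) - 4 * pi / (1 - 0\<^sup>2) = 4 * pi * r\<^sup>2 / (1 - r\<^sup>2)"
    using r2[of r] assms by (simp add: divide_simps) (simp add: algebra_simps)
  finally show "(\<integral>\<^sup>+w. ennreal (indicator (cball 0 r) w * (poincare_density w)\<^sup>2) \<partial>lborel) = ennreal (4 * pi * r\<^sup>2 / (1 - r\<^sup>2))" .
  show "(\<lambda>w. indicator (cball 0 r) w * (poincare_density w)\<^sup>2) \<in> borel_measurable lborel"
    using measurable_indicator_density[of "cball 0 r"] by simp
qed auto

text \<open>For \<open>u = circlepath 0 1 t\<close>, which is
  \<open>exp (2 * pi * \<i> * t)\<close>, the form \<open>du / u\<close> is
  \<open>2 * pi * \<i> * dt\<close>, so Cauchy's formula becomes an average over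
  \<open>t\<close>.\<close>

lemma mean_value_unit_circle:
  assumes "f holomorphic_on cball 0 1"
  shows "((\<lambda>t. f (circlepath 0 1 t)) has_integral f 0) {0..1}"
proof -
  have "((\<lambda>u. f u / (u - 0)) has_contour_integral (2 * of_real pi * \<i> * f 0)) (circlepath 0 1)"
    using assms by (rule Cauchy_integral_circlepath_simple) simp
  then have "((\<lambda>t. (2 * of_real pi * \<i>) * f (circlepath 0 1 t)) has_integral (2 * of_real pi * \<i>) * f 0) {0..1}"
    unfolding has_contour_integral_def
    by (rule has_integral_eq[rotated]) (simp add: vector_derivative_circlepath01, simp add: circlepath)
  then have "((\<lambda>t. inverse (2 * of_real pi * \<i>) * ((2 * of_real pi * \<i>) * f (circlepath 0 1 t))) 
     has_integral inverse (2 * of_real pi * \<i>) * ((2 * of_real pi * \<i>) * f 0)) {0..1}"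
    by (rule has_integral_mult_right)
  then show ?thesis by (simp add: field_simps)
qed

lemma cmod_circlepath_0_1: "cmod (circlepath 0 1 t) = 1"
  by (simp add: circlepath norm_exp_eq_Re)

text \<open>For \<open>w\<close> nearer to 0 than \<open>z\<close> the kernel is holomorphic in the
  rotation \<open>u\<close> throughout the closed disc, and its value at \<open>u = 0\<close> is
  \<open>1 / z\<close>. Otherwise it has a pole there; but \<open>cnj u = 1 / u\<close> on the
  circle, so its conjugate agrees with a function holomorphic on the disc that vanishes at
  0.\<close>

lemma mean_inverse_unit_circle:
  assumes "cmod w \<noteq> cmod z"
  shows "((\<lambda>t. 1 / (z - circlepath 0 1 t * w)) has_integral (if cmod w < cmod z then 1 / z else 0)) {0..1}"
proof (cases "cmod w < cmod z")
  case True
  have "z - u * w \<noteq> 0" if "cmod u \<le> 1" for u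
    using True that mult_right_mono[OF that, of "cmod w"] by (auto simp flip: norm_mult)
  then have "(\<lambda>u. 1 / (z - u * w)) holomorphic_on cball 0 1"
    by (auto intro!: holomorphic_intros)
  from mean_value_unit_circle[OF this] show ?thesis using True by simp
next
  case False
  with assms have lt: "cmod z < cmod w" by simp
  have "cnj w - u * cnj z \<noteq> 0" if "cmod u \<le> 1" for u
    using lt that mult_right_mono[OF that, of "cmod z"]
    by (metis complex_mod_cnj eq_iff_diff_eq_0 linorder_not_le mult_1 norm_ge_zero norm_mult)
  then have "(\<lambda>u. - u / (cnj w - u * cnj z)) holomorphic_on cball 0 1"
    by (auto intro!: holomorphic_intros)
  from mean_value_unit_circle[OF this]
  have "((\<lambda>t. cnj (- circlepath 0 1 t / (cnj w - circlepath 0 1 t * cnj z))) has_integral cnj 0) {0..1}"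
    by (subst has_integral_cnj[unfolded o_def]) simp
  moreover have "cnj (- u / (cnj w - u * cnj z)) = 1 / (z - u * w)" if "cmod u = 1" for u
  proof -
    have u: "u * cnj u = 1" using complex_norm_square[of u] that by simp
    then have "cnj u \<noteq> 0" by auto
    have "w - cnj u * z = - cnj u * (z - u * w)"
      using u by (simp add: right_diff_distrib) (simp add: mult.commute mult.left_commute)
    then have "cnj (- u / (cnj w - u * cnj z)) = (- cnj u) / (- cnj u * (z - u * w))"
      by simp
    also have "\<dots> = 1 / (z - u * w)" using \<open>cnj u \<noteq> 0\<close> by simp
    finally show ?thesis .
  qed
  ultimately show ?thesis
    using lt by (simp add: cmod_circlepath_0_1)
qed

text \<open>The absolute bound behind both uses of Fubini: the squared density is at most
  \<open>(2 / (1 - R^2))^2\<close> on the smaller disc, and \<open>4 * pi\<close> bounds the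
  integral of the pole. Uniformity in \<open>z\<close> is what allows a further integration over the
  curve or over the rotations.\<close>

lemma nn_integral_cauchy_kernel_le:
  assumes "R < 1" "cmod z \<le> 1"
  shows "(\<integral>\<^sup>+w. ennreal (cmod (complex_of_real (indicator (ball 0 R) w * (poincare_density w)\<^sup>2) / (z - w))) \<partial>lborel)
     \<le> ennreal ((2 / (1 - R\<^sup>2))\<^sup>2 * (4 * pi))"
proof -
  have le: "indicator (ball 0 R) w * (poincare_density w)\<^sup>2 \<le> (2 / (1 - R\<^sup>2))\<^sup>2 * indicator (ball 0 1) w" for w
  proof (cases "w \<in> ball 0 R")
    case True
    then have "0 < R" "cmod w < R" by (auto intro: le_less_trans[OF norm_ge_zero])
    then have "poincare_density w \<le> poincare_density (of_real R)"
      using assms by (intro poincare_density_mono) auto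
    then have "poincare_density w \<le> 2 / (1 - R\<^sup>2)"
      by (simp add: poincare_density_def)
    then show ?thesis
      using True assms by (auto simp: indicator_def intro!: power_mono less_imp_le[OF poincare_density_pos])
  qed (simp add: indicator_def)
  have "(\<integral>\<^sup>+w. ennreal (cmod (complex_of_real (indicator (ball 0 R) w * (poincare_density w)\<^sup>2) / (z - w))) \<partial>lborel)
     \<le> (\<integral>\<^sup>+w. ennreal ((2 / (1 - R\<^sup>2))\<^sup>2) * (indicator (ball 0 1) w * ennreal (1 / cmod (z - w))) \<partial>lborel)"
  proof (rule nn_integral_mono)
    fix w
    have "cmod (complex_of_real (indicator (ball 0 R) w * (poincare_density w)\<^sup>2) / (z - w))
       = indicator (ball 0 R) w * (poincare_density w)\<^sup>2 / cmod (z - w)"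
      by (simp add: norm_divide norm_mult norm_power)
    also have "\<dots> \<le> (2 / (1 - R\<^sup>2))\<^sup>2 * indicator (ball 0 1) w / cmod (z - w)"
      by (intro divide_right_mono le) auto
    finally show "ennreal (cmod (complex_of_real (indicator (ball 0 R) w * (poincare_density w)\<^sup>2) / (z - w)))
      \<le> ennreal ((2 / (1 - R\<^sup>2))\<^sup>2) * (indicator (ball 0 1) w * ennreal (1 / cmod (z - w)))"
      by (auto simp: indicator_def ennreal_mult[symmetric] intro!: ennreal_leI)
  qed
  also have "\<dots> = ennreal ((2 / (1 - R\<^sup>2))\<^sup>2) * (\<integral>\<^sup>+w. indicator (ball 0 1) w * ennreal (1 / cmod (z - w)) \<partial>lborel)"
    by (rule nn_integral_cmult, intro borel_measurable_times_ennreal borel_measurable_indicator) auto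
  also have "\<dots> \<le> ennreal ((2 / (1 - R\<^sup>2))\<^sup>2) * ennreal (4 * pi)"
    by (intro mult_left_mono nn_integral_inverse_dist_le assms) auto
  finally show ?thesis by (simp add: ennreal_mult)
qed

lemma measurable_circlepath [measurable]: "circlepath z r \<in> borel_measurable borel"
  unfolding circlepath by measurable

text \<open>Newton's shell theorem: averaging \<open>1 / (z - w)\<close> over the rotations of \<open>w\<close> leaves
  \<open>1 / z\<close> times the mass of the disc of radius \<open>\<bar>z\<bar>\<close>.\<close>
lemma cauchy_transform_hyperbolic_area:
  assumes "cmod z < R" "R < 1"
  shows "(\<integral>w. complex_of_real (indicator (ball 0 R) w * (poincare_density w)\<^sup>2) / (z - w) \<partial>lborel)
    = 4 * pi * cnj z / (1 - (cmod z)\<^sup>2)"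
proof -
  define \<phi> where "\<phi> w = indicator (ball 0 R) w * (poincare_density w)\<^sup>2" for w :: complex
  have \<phi>m [measurable]: "\<phi> \<in> borel_measurable borel"
    unfolding \<phi>_def by (intro measurable_indicator_density) simp
  define e where "e = circlepath 0 1"
  have em [measurable]: "e \<in> borel_measurable borel" unfolding e_def by measurable
  have ne: "cmod (e t) = 1" for t by (simp add: e_def cmod_circlepath_0_1)
  have rot: "distr lborel borel ((*) (e t)) = lborel" for t
    by (intro lborel_distr_rotation ne)
  have \<phi>e: "\<phi> (e t * w) = \<phi> w" for t w
    by (simp add: \<phi>_def poincare_density_def norm_mult ne indicator_def)
  \<comment> \<open>The rotation parameter \<open>t\<close> is an artificial second variable. Since
    \<open>\<phi>\<close> and Lebesgue measure are rotation invariant, the integral over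
    \<open>w\<close> is the same for every \<open>t\<close> in \<open>{0..1}\<close>; integrating
    over \<open>t\<close> first replaces the kernel by its circular mean.\<close>
  define h where "h t w = complex_of_real (indicator {0..1} t * \<phi> w) / (z - e t * w)" for t :: real and w
  have [measurable]: "(\<lambda>x. h (fst x) (snd x)) \<in> borel_measurable (lborel \<Otimes>\<^sub>M lborel)"
    unfolding h_def by measurable
  have bound: "(\<integral>\<^sup>+w. ennreal (cmod (h t w)) \<partial>lborel) \<le> ennreal ((2 / (1 - R\<^sup>2))\<^sup>2 * (4 * pi)) * indicator {0..1} t" for t
  proof -
    have "(\<integral>\<^sup>+w. ennreal (cmod (h t w)) \<partial>lborel)
       = (\<integral>\<^sup>+w. ennreal (cmod (complex_of_real (\<phi> (e t * w)) / (z - e t * w))) * indicator {0..1} t \<partial>lborel)"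
      by (intro nn_integral_cong) (auto simp: h_def indicator_def \<phi>e)
    also have "\<dots> = (\<integral>\<^sup>+w. ennreal (cmod (complex_of_real (\<phi> w) / (z - w))) * indicator {0..1} t \<partial>distr lborel borel ((*) (e t)))"
      by (subst nn_integral_distr) auto
    also have "\<dots> = (\<integral>\<^sup>+w. ennreal (cmod (complex_of_real (\<phi> w) / (z - w))) \<partial>lborel) * indicator {0..1} t"
      unfolding rot by (rule nn_integral_multc) auto
    also have "\<dots> \<le> ennreal ((2 / (1 - R\<^sup>2))\<^sup>2 * (4 * pi)) * indicator {0..1} t"
      using assms unfolding \<phi>_def by (intro mult_right_mono nn_integral_cauchy_kernel_le) auto
    finally show ?thesis .
  qed
  have int: "integrable (lborel \<Otimes>\<^sub>M lborel) (case_prod h)"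
  proof (rule integrableI_bounded)
    have "(\<integral>\<^sup>+x. ennreal (cmod (case_prod h x)) \<partial>(lborel \<Otimes>\<^sub>M lborel)) = (\<integral>\<^sup>+t. \<integral>\<^sup>+w. ennreal (cmod (h t w)) \<partial>lborel \<partial>lborel)"
      by (subst lborel.nn_integral_fst[symmetric]) (auto simp: split_def)
    also have "\<dots> \<le> (\<integral>\<^sup>+t. ennreal ((2 / (1 - R\<^sup>2))\<^sup>2 * (4 * pi)) * indicator {0..1::real} t \<partial>lborel)"
      by (intro nn_integral_mono bound)
    also have "\<dots> < \<infinity>"
      by (simp add: nn_integral_cmult)
    finally show "(\<integral>\<^sup>+x. ennreal (cmod (case_prod h x)) \<partial>(lborel \<Otimes>\<^sub>M lborel)) < \<infinity>" .
  qed (simp add: split_def)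
  have "(\<integral>w. complex_of_real (\<phi> w) / (z - w) \<partial>lborel) = (\<integral>t. \<integral>w. h t w \<partial>lborel \<partial>lborel)"
  proof -
    have "(\<integral>w. h t w \<partial>lborel) = indicator {0..1} t *\<^sub>R (\<integral>w. complex_of_real (\<phi> w) / (z - w) \<partial>lborel)" for t
    proof -
      have "(\<integral>w. complex_of_real (\<phi> w) / (z - w) \<partial>lborel) = (\<integral>w. complex_of_real (\<phi> w) / (z - w) \<partial>distr lborel borel ((*) (e t)))"
        by (simp add: rot)
      also have "\<dots> = (\<integral>w. complex_of_real (\<phi> w) / (z - e t * w) \<partial>lborel)"
        by (subst integral_distr) (auto simp: \<phi>e)
      finally show ?thesis by (simp add: h_def indicator_def)
    qed
    then show ?thesis by simp
  qed
  also have "\<dots> = (\<integral>w. \<integral>t. h t w \<partial>lborel \<partial>lborel)"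
    using lborel_pair.Fubini_integral[OF int] by simp
  also have "\<dots> = (\<integral>w. complex_of_real (indicator (cball 0 (cmod z)) w * (poincare_density w)\<^sup>2) * (1 / z) \<partial>lborel)"
  proof (rule integral_cong_AE)
    \<comment> \<open>The circular mean is not computed for \<open>cmod w = cmod z\<close>, a null
      set. As \<open>cmod z < R\<close>, the cutoff at \<open>R\<close> does not touch the disc that
      survives.\<close>
    have "AE w in lborel. w \<notin> sphere 0 (cmod z)"
      using negligible_sphere[of 0 "cmod z"]
      by (intro AE_not_in) (auto simp: null_sets_completion_iff negligible_iff_null_sets)
    then show "AE w in lborel. (\<integral>t. h t w \<partial>lborel) = complex_of_real (indicator (cball 0 (cmod z)) w * (poincare_density w)\<^sup>2) * (1 / z)"
    proof eventually_elim
      case (elim w)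
      then have w: "cmod w \<noteq> cmod z" by simp
      have nz: "z - e t * w \<noteq> 0" for t
        using w ne[of t] by (metis eq_iff_diff_eq_0 mult_1 norm_mult)
      have "set_integrable lborel {0..1} (\<lambda>t. 1 / (z - e t * w))"
        unfolding set_integrable_def
        using nz by (intro borel_integrable_compact) (auto simp: e_def circlepath intro!: continuous_intros)
      from set_borel_integral_eq_integral(2)[OF this] mean_inverse_unit_circle[OF w]
      have "(LINT t:{0..1}|lborel. 1 / (z - e t * w)) = (if cmod w < cmod z then 1 / z else 0)"
        by (simp add: e_def integral_unique)
      moreover have "(\<integral>t. h t w \<partial>lborel) = complex_of_real (\<phi> w) * (LINT t:{0..1}|lborel. 1 / (z - e t * w))"
        unfolding set_lebesgue_integral_def integral_mult_right_zero[symmetric]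
        by (intro Bochner_Integration.integral_cong) (auto simp: h_def indicator_def)
      ultimately show ?case
        using w assms by (auto simp: \<phi>_def indicator_def)
    qed
    have "case_prod (\<lambda>w t. h t w) \<in> borel_measurable (lborel \<Otimes>\<^sub>M lborel)"
      unfolding h_def split_def by measurable
    then show "(\<lambda>w. \<integral>t. h t w \<partial>lborel) \<in> borel_measurable lborel"
      by (rule lborel.borel_measurable_lebesgue_integral)
    show "(\<lambda>w. complex_of_real (indicator (cball 0 (cmod z)) w * (poincare_density w)\<^sup>2) * (1 / z)) \<in> borel_measurable lborel"
      using borel_measurable_times[OF measurable_compose[OF measurable_indicator_density[of "cball 0 (cmod z)"]
          borel_measurable_of_real] borel_measurable_const[of "1 / z"]] by simp
  qed
  also have "\<dots> = complex_of_real (\<integral>w. indicator (cball 0 (cmod z)) w * (poincare_density w)\<^sup>2 \<partial>lborel) * (1 / z)"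
    by (simp only: integral_mult_left_zero integral_complex_of_real)
  also have "\<dots> = complex_of_real (4 * pi * (cmod z)\<^sup>2 / (1 - (cmod z)\<^sup>2)) * (1 / z)"
    using hyperbolic_disc_area[of "cmod z"] assms by (simp add: has_bochner_integral_iff)
  \<comment> \<open>\<open>(cmod z)^2 / z = cnj z\<close>; for \<open>z = 0\<close> both sides
    vanish because \<open>1 / 0 = 0\<close>.\<close>
  also have "\<dots> = 4 * pi * cnj z / (1 - (cmod z)\<^sup>2)"
    by (cases "z = 0") (simp_all add: complex_norm_square del: of_real_power)
  finally show ?thesis by (simp add: \<phi>_def)
qed

section \<open>Hyperbolic length and geodesics\<close>

lemma one_minus_cnj_mult_nonzero:
  assumes "cmod a < 1" "cmod z < 1"
  shows "1 - cnj a * z \<noteq> 0"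
proof
  assume "1 - cnj a * z = 0"
  then have "cmod (cnj a * z) = 1" by simp
  moreover have "cmod (cnj a * z) < 1 * 1"
    unfolding norm_mult using assms by (intro mult_strict_mono') auto
  ultimately show False by simp
qed

lemma norm_Moebius_identity:
  "(cmod (1 - cnj a * z))\<^sup>2 - (cmod (z - a))\<^sup>2 = (1 - (cmod a)\<^sup>2) * (1 - (cmod z)\<^sup>2)"
  unfolding cmod_power2 by (simp add: algebra_simps power2_eq_square)

lemma one_minus_norm_Moebius:
  assumes "cmod a < 1" "cmod z < 1"
  shows "1 - (cmod (Moebius_function 0 a z))\<^sup>2 = (1 - (cmod a)\<^sup>2) * (1 - (cmod z)\<^sup>2) / (cmod (1 - cnj a * z))\<^sup>2"
  using one_minus_cnj_mult_nonzero[OF assms] norm_Moebius_identity[of a z]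
  by (simp add: Moebius_function_simple norm_divide power_divide divide_simps)

lemma Moebius_function_has_field_derivative:
  assumes "cmod a < 1" "cmod z < 1"
  shows "(Moebius_function 0 a has_field_derivative ((1 - (cmod a)\<^sup>2) / (1 - cnj a * z)\<^sup>2)) (at z)"
proof -
  have nz: "1 - cnj a * z \<noteq> 0" by (rule one_minus_cnj_mult_nonzero[OF assms])
  have d: "((\<lambda>z. (z - a) / (1 - cnj a * z)) has_field_derivative
      (((1 - cnj a * z) - (z - a) * (- cnj a)) / (1 - cnj a * z)\<^sup>2)) (at z)"
    using nz by (auto intro!: derivative_eq_intros simp: power2_eq_square)
  have eq: "(1 - cnj a * z) - (z - a) * (- cnj a) = 1 - complex_of_real ((cmod a)\<^sup>2)"
    unfolding complex_norm_square by (simp add: algebra_simps)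
  show ?thesis
    using d[unfolded eq] by (simp add: Moebius_function_simple[abs_def])
qed

text \<open>Moebius maps are isometries: the second factor is the modulus of the derivative of the
  map at \<open>z\<close>.\<close>

lemma poincare_density_Moebius:
  assumes "cmod a < 1" "cmod z < 1"
  shows "poincare_density (Moebius_function 0 a z) * cmod (complex_of_real (1 - (cmod a)\<^sup>2) / (1 - cnj a * z)\<^sup>2)
    = poincare_density z"
proof -
  have "1 - (cmod a)\<^sup>2 > 0" using assms by (simp add: abs_square_less_1)
  then have "cmod (complex_of_real (1 - (cmod a)\<^sup>2)) = 1 - (cmod a)\<^sup>2"
    by (simp only: norm_of_real abs_of_pos)
  then show ?thesis
    using one_minus_cnj_mult_nonzero[OF assms] \<open>1 - (cmod a)\<^sup>2 > 0\<close>
    unfolding poincare_density_def one_minus_norm_Moebius[OF assms] norm_divide norm_power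
    by (simp add: divide_simps)
qed

text \<open>A calibration argument: the left side is the hyperbolic distance of the end points, and
  a function that grows by this amount along \<open>h\<close> has derivative at most the length
  integrand. The finite set \<open>S\<close> holds the points where \<open>h\<close> need not be
  differentiable. The measurability claim allows the lengths of two pieces of a curve to be
  added.\<close>

lemma hyperbolic_distance_le_length:
  fixes h :: "real \<Rightarrow> complex"
  assumes "\<alpha> \<le> \<beta>" "finite S" and cont: "continuous_on {\<alpha>..\<beta>} h" and C1: "h C1_differentiable_on ({\<alpha>..\<beta>} - S)"
    and disc: "h ` {\<alpha>..\<beta>} \<subseteq> ball 0 1"
  shows "ennreal (2 * artanh (cmod (Moebius_function 0 (h \<alpha>) (h \<beta>)))) \<le>
    (\<integral>\<^sup>+t. ennreal (indicator ({\<alpha>..\<beta>} - S) t * (poincare_density (h t) * cmod (vector_derivative h (at t)))) \<partial>lborel)"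
    (is "_ \<le> ?I")
    and "(\<lambda>t. indicator ({\<alpha>..\<beta>} - S) t * (poincare_density (h t) * cmod (vector_derivative h (at t)))) \<in> borel_measurable borel"
proof -
  define F where "F t = poincare_density (h t) * cmod (vector_derivative h (at t))" for t
  have hd: "cmod (h t) < 1" if "t \<in> {\<alpha>..\<beta>}" for t using disc that by (auto simp: image_subset_iff)
  have sq: "1 - (cmod (h t))\<^sup>2 > 0" if "t \<in> {\<alpha>..\<beta>}" for t
    using hd[OF that] by (simp add: abs_square_less_1)
  have F0: "F t \<ge> 0" if "t \<in> {\<alpha>..\<beta>}" for t
    unfolding F_def using poincare_density_pos[OF hd[OF that]] by simp
  have "continuous_on ({\<alpha>..\<beta>} - S) F"
    unfolding F_def poincare_density_def
  proof (intro continuous_intros)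
    show "continuous_on ({\<alpha>..\<beta>} - S) h" using cont by (rule continuous_on_subset) auto
    show "continuous_on ({\<alpha>..\<beta>} - S) (\<lambda>t. vector_derivative h (at t))"
      using C1 by (simp add: C1_differentiable_on_eq)
    show "\<forall>t\<in>{\<alpha>..\<beta>} - S. 1 - (cmod (h t))\<^sup>2 \<noteq> 0" using sq by fastforce
  qed
  then have "(\<lambda>t. indicator ({\<alpha>..\<beta>} - S) t *\<^sub>R F t) \<in> borel_measurable borel"
    using finite_imp_closed[OF \<open>finite S\<close>]
    by (intro borel_measurable_continuous_on_indicator sets.Diff borel_closed) auto
  then have Fm: "(\<lambda>t. indicator ({\<alpha>..\<beta>} - S) t * F t) \<in> borel_measurable borel"
    by simp
  then show "(\<lambda>t. indicator ({\<alpha>..\<beta>} - S) t * (poincare_density (h t) * cmod (vector_derivative h (at t)))) \<in> borel_measurable borel"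
    by (simp add: F_def)
  define a where "a = h \<alpha>"
  have a: "cmod a < 1" using hd \<open>\<alpha> \<le> \<beta>\<close> by (simp add: a_def)
  define u where "u t = Moebius_function 0 a (h t)" for t
  have u: "cmod (u t) < 1" if "t \<in> {\<alpha>..\<beta>}" for t
    unfolding u_def by (rule Moebius_function_norm_lt_1[OF a hd[OF that]])
  \<comment> \<open>\<open>2 artanh (Re (e u))\<close> is smooth, unlike the distance \<open>2 artanh \<bar>u\<bar>\<close> to the origin, and agrees with it at \<open>\<beta>\<close>.\<close>
  obtain e where e: "cmod e = 1" "e * u \<beta> = of_real (cmod (u \<beta>))"
  proof (cases "u \<beta> = 0")
    case True
    show ?thesis by (rule that[of 1]) (use True in auto)
  next
    case False
    show ?thesis
      by (rule that[of "cnj (u \<beta>) / of_real (cmod (u \<beta>))"])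
         (use False in \<open>auto simp: norm_divide divide_simps complex_norm_square[symmetric] mult.commute[of "cnj _"] power2_eq_square\<close>)
  qed
  have Re_eu: "\<bar>Re (e * u t)\<bar> \<le> cmod (u t)" for t
    using abs_Re_le_cmod[of "e * u t"] e by (simp add: norm_mult)
  define f where "f t = 2 * artanh (Re (e * u t))" for t
  define u' where "u' t = vector_derivative h (at t) * (complex_of_real (1 - (cmod a)\<^sup>2) / (1 - cnj a * h t)\<^sup>2)" for t
  define f' where "f' t = 2 / (1 - (Re (e * u t))\<^sup>2) * Re (e * u' t)" for t
  have ud: "(u has_vector_derivative u' t) (at t)" if t: "t \<in> {\<alpha>..\<beta>} - S" for t
  proof -
    have "(h has_vector_derivative vector_derivative h (at t)) (at t)"
      using C1 t by (auto simp: C1_differentiable_on_eq vector_derivative_works)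
    from field_vector_diff_chain_at[OF this Moebius_function_has_field_derivative[OF a hd]] t
    show ?thesis by (simp add: u_def[abs_def] u'_def o_def)
  qed
  have fd: "(f has_vector_derivative f' t) (at t)" if t: "t \<in> {\<alpha>..\<beta>} - S" for t
  proof -
    have "((\<lambda>t. e * u t) has_vector_derivative e * u' t) (at t)"
      using ud[OF t] by (rule has_vector_derivative_mult_right)
    then have "((\<lambda>t. Re (e * u t)) has_vector_derivative Re (e * u' t)) (at t)"
      by (rule bounded_linear.has_vector_derivative[OF bounded_linear_Re])
    then have d: "((\<lambda>t. Re (e * u t)) has_real_derivative Re (e * u' t)) (at t)"
      by (simp add: has_real_derivative_iff_has_vector_derivative)
    have "\<bar>Re (e * u t)\<bar> < 1" using Re_eu[of t] u[of t] t by auto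
    from DERIV_cmult[OF DERIV_chain2[OF artanh_real_has_field_derivative[OF this] d], of 2]
    have "(f has_real_derivative f' t) (at t)"
      by (simp only: f_def[abs_def] f'_def times_divide_eq_right times_divide_eq_left mult_1 mult_1_right)
    then show ?thesis by (simp add: has_real_derivative_iff_has_vector_derivative)
  qed
  \<comment> \<open>Passing to real parts can only decrease both the speed and the density; what is
    left is the length integrand seen through the Moebius isometry.\<close>
  have fle: "f' t \<le> F t" if t: "t \<in> {\<alpha>..\<beta>}" for t
  proof -
    have "f' t \<le> 2 / (1 - (Re (e * u t))\<^sup>2) * cmod (u' t)"
      unfolding f'_def
      using Re_eu[of t] u[OF t] complex_Re_le_cmod[of "e * u' t"] e
      by (intro mult_left_mono) (auto simp: norm_mult abs_square_le_1)
    also have "\<dots> \<le> poincare_density (u t) * cmod (u' t)"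
    proof (rule mult_right_mono)
      have "1 - (cmod (u t))\<^sup>2 > 0" using u[OF t] by (simp add: abs_square_less_1)
      moreover have "(Re (e * u t))\<^sup>2 \<le> (cmod (u t))\<^sup>2"
        using power_mono[OF Re_eu[of t] abs_ge_zero, of 2] by simp
      ultimately show "2 / (1 - (Re (e * u t))\<^sup>2) \<le> poincare_density (u t)"
        unfolding poincare_density_def by (intro divide_left_mono) auto
    qed simp
    also have "\<dots> = cmod (vector_derivative h (at t)) *
        (poincare_density (Moebius_function 0 a (h t)) * cmod (complex_of_real (1 - (cmod a)\<^sup>2) / (1 - cnj a * h t)\<^sup>2))"
      unfolding u'_def u_def norm_mult by (simp only: mult_ac)
    also have "\<dots> = F t"
      unfolding poincare_density_Moebius[OF a hd[OF t]] F_def by (simp only: mult_ac)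
    finally show ?thesis .
  qed
  have "(f' has_integral (f \<beta> - f \<alpha>)) {\<alpha>..\<beta>}"
  proof (rule fundamental_theorem_of_calculus_interior_strong[OF \<open>finite S\<close> \<open>\<alpha> \<le> \<beta>\<close>])
    show "(f has_vector_derivative f' x) (at x)" if "x \<in> {\<alpha><..<\<beta>} - S" for x
      using fd that by auto
    show "continuous_on {\<alpha>..\<beta>} f"
      unfolding f_def
    proof (intro continuous_on_mult_left continuous_on_artanh' continuous_on_Re)
      show "continuous_on {\<alpha>..\<beta>} u"
        unfolding u_def Moebius_function_simple
        using cont one_minus_cnj_mult_nonzero[OF a hd] by (auto intro!: continuous_intros)
      show "Re (e * u x) \<in> {-1<..<1}" if "x \<in> {\<alpha>..\<beta>}" for x
        using Re_eu[of x] u[OF that] by auto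
    qed
  qed
  moreover have "f \<alpha> = 0" by (simp add: f_def u_def a_def Moebius_function_eq_zero)
  moreover have "f \<beta> = 2 * artanh (cmod (u \<beta>))" by (simp add: f_def e)
  ultimately have "(f' has_integral (2 * artanh (cmod (u \<beta>)))) {\<alpha>..\<beta>}" by simp
  then have "((\<lambda>t. indicator ({\<alpha>..\<beta>} - S) t * f' t) has_integral (2 * artanh (cmod (u \<beta>)))) {\<alpha>..\<beta>}"
    by (rule has_integral_spike_finite[OF \<open>finite S\<close>, rotated]) auto
  then have fi: "((\<lambda>t. indicator ({\<alpha>..\<beta>} - S) t * f' t) has_integral (2 * artanh (cmod (u \<beta>)))) UNIV"
    by (rule has_integral_on_superset) auto
  have "ennreal (2 * artanh (cmod (u \<beta>))) \<le> (\<integral>\<^sup>+t. ennreal (indicator ({\<alpha>..\<beta>} - S) t * F t) \<partial>lborel)"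
  \<comment> \<open>Infinite length makes the bound trivial. Finite length makes the integrand
    Lebesgue integrable, hence comparable with the gauge integral of \<open>f'\<close>.\<close>
  proof (cases "(\<integral>\<^sup>+t. ennreal (indicator ({\<alpha>..\<beta>} - S) t * F t) \<partial>lborel) = \<infinity>")
    case False
    have nn: "indicator ({\<alpha>..\<beta>} - S) t * F t \<ge> 0" for t using F0 by (simp add: indicator_def)
    have int: "integrable lborel (\<lambda>t. indicator ({\<alpha>..\<beta>} - S) t * F t)"
      using False Fm nn by (intro integrableI_nonneg) (auto simp: less_top)
    have "2 * artanh (cmod (u \<beta>)) \<le> (\<integral>t. indicator ({\<alpha>..\<beta>} - S) t * F t \<partial>lborel)"
      by (rule has_integral_le[OF fi has_integral_integral_lborel[OF int]])
         (use fle in \<open>auto simp: indicator_def\<close>)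
    then show ?thesis
      using nn_integral_eq_integral[OF int] nn by (simp add: ennreal_leI)
  qed simp
  then show "ennreal (2 * artanh (cmod (Moebius_function 0 (h \<alpha>) (h \<beta>)))) \<le> ?I"
    by (simp add: u_def a_def F_def)
qed

text \<open>The Moebius map taking \<open>a\<close> to \<open>0\<close> turns the geodesic from \<open>a\<close> to \<open>b\<close> into a Euclidean segment.\<close>
definition geodesic_arc :: "complex \<Rightarrow> complex \<Rightarrow> real \<Rightarrow> complex" where
  "geodesic_arc a b t = Moebius_function 0 (- a) (of_real t * Moebius_function 0 a b)"

text \<open>After moving \<open>a\<close> to 0, with \<open>u\<close> and \<open>c\<close> the
  images of \<open>w\<close> and \<open>b\<close>, the hypothesis forces
  \<open>Re (cnj u * c) = cmod u * cmod c\<close> and \<open>cmod u \<le> cmod c\<close>. This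
  equality case of Cauchy-Schwarz puts \<open>u\<close> on the segment from 0 to
  \<open>c\<close>.\<close>

lemma hyperbolic_triangle_equality:
  assumes "cmod a < 1" "cmod b < 1" "cmod w < 1"
    and le: "artanh (cmod (Moebius_function 0 a w)) + artanh (cmod (Moebius_function 0 w b)) \<le> artanh (cmod (Moebius_function 0 a b))"
  shows "w \<in> path_image (geodesic_arc a b)"
proof -
  define u where "u = Moebius_function 0 a w"
  define c where "c = Moebius_function 0 a b"
  have u: "cmod u < 1" and c: "cmod c < 1"
    unfolding u_def c_def using assms by (simp_all add: Moebius_function_norm_lt_1)
  have nz: "1 - cnj a * b \<noteq> 0" "1 - cnj a * w \<noteq> 0" "1 - cnj w * a \<noteq> 0" "1 - cnj w * b \<noteq> 0" "1 - cnj u * c \<noteq> 0" "1 - cnj a * a \<noteq> 0"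
    by (rule one_minus_cnj_mult_nonzero; simp add: assms(1-3) u c)+
  \<comment> \<open>Invariance of the distance: \<open>w\<close> and \<open>b\<close> are as far
    apart as their images \<open>u\<close> and \<open>c\<close>.\<close>
  have inv: "cmod (Moebius_function 0 w b) = cmod (c - u) / cmod (1 - cnj u * c)"
  proof -
    have "(b - a) * (1 - cnj a * w) - (w - a) * (1 - cnj a * b) = (1 - cnj a * a) * (b - w)"
      by (simp add: algebra_simps)
    then have 1: "c - u = (1 - cnj a * a) * (b - w) / ((1 - cnj a * b) * (1 - cnj a * w))"
      unfolding c_def u_def Moebius_function_simple diff_frac_eq[OF nz(1) nz(2)] by simp
    have aw: "1 - a * cnj w \<noteq> 0" using nz(3) by (simp add: mult.commute)
    have "1 - cnj u * c = 1 - (cnj w - cnj a) * (b - a) / ((1 - a * cnj w) * (1 - cnj a * b))"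
      by (simp add: c_def u_def Moebius_function_simple)
    also have "\<dots> = ((1 - a * cnj w) * (1 - cnj a * b) - (cnj w - cnj a) * (b - a)) / ((1 - a * cnj w) * (1 - cnj a * b))"
      unfolding diff_divide_distrib using nz(1) aw by simp
    also have "(1 - a * cnj w) * (1 - cnj a * b) - (cnj w - cnj a) * (b - a) = (1 - cnj a * a) * (1 - cnj w * b)"
      by (simp add: algebra_simps)
    finally have 2: "1 - cnj u * c = (1 - cnj a * a) * (1 - cnj w * b) / ((1 - a * cnj w) * (1 - cnj a * b))" .
    have "1 - a * cnj w = cnj (1 - cnj a * w)" by simp
    then have 3: "cmod (1 - a * cnj w) = cmod (1 - cnj a * w)"
      by (simp only: complex_mod_cnj)
    show ?thesis
      unfolding 1 2 norm_divide norm_mult 3 Moebius_function_simple using nz by (simp add: divide_simps)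
  qed
  define p where "p = cmod u"
  define r where "r = cmod c"
  define \<beta> where "\<beta> = cmod (Moebius_function 0 w b)"
  have p: "0 \<le> p" "p < 1" and r: "0 \<le> r" "r < 1" and \<beta>: "0 \<le> \<beta>" "\<beta> < 1"
    using u c assms by (auto simp: p_def r_def \<beta>_def Moebius_function_norm_lt_1)
  have "ln ((1 + p) / (1 - p)) + ln ((1 + \<beta>) / (1 - \<beta>)) \<le> ln ((1 + r) / (1 - r))"
    using le by (simp add: artanh_def p_def r_def \<beta>_def u_def c_def)
  then have "ln ((1 + p) / (1 - p) * ((1 + \<beta>) / (1 - \<beta>))) \<le> ln ((1 + r) / (1 - r))"
    using p \<beta> by (subst ln_mult) auto
  moreover have "0 < (1 + p) / (1 - p) * ((1 + \<beta>) / (1 - \<beta>))" "0 < (1 + r) / (1 - r)"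
    using p r \<beta> by (simp_all add: add_pos_nonneg)
  ultimately have "(1 + p) * (1 + \<beta>) / ((1 - p) * (1 - \<beta>)) \<le> (1 + r) / (1 - r)"
    by (simp only: ln_le_cancel_iff times_divide_times_eq)
  moreover have "0 < (1 - p) * (1 - \<beta>)" "0 < 1 - r"
    using p r \<beta> by simp_all
  ultimately have "(1 + p) * (1 + \<beta>) * (1 - r) \<le> (1 + r) * ((1 - p) * (1 - \<beta>))"
    by (simp only: pos_divide_le_eq pos_le_divide_eq times_divide_eq_left)
  \<comment> \<open>The subtraction formula of \<open>artanh\<close> in disguise:
    \<open>\<beta> \<le> (r - p) / (1 - r * p)\<close>, where the right side would be the value of
    \<open>\<beta>\<close> for \<open>u\<close> and \<open>c\<close> on a common ray.\<close>
  then have *: "\<beta> * (1 - r * p) \<le> r - p"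
    by (simp add: algebra_simps)
  have rp: "r * p < 1" using p r mult_left_mono[of p 1 r] by simp
  then have "0 \<le> \<beta> * (1 - r * p)" using \<beta> by simp
  with * have "p \<le> r" by simp
  define N where "N = cmod (1 - cnj u * c)"
  have "N > 0" using nz by (simp add: N_def)
  have "N\<^sup>2 - (\<beta> * N)\<^sup>2 = (1 - p\<^sup>2) * (1 - r\<^sup>2)"
    using norm_Moebius_identity[of u c] inv \<open>N > 0\<close> by (simp add: N_def p_def r_def \<beta>_def)
  \<comment> \<open>Uses \<open>(1 - p^2) * (1 - r^2) = (1 - r * p)^2 - (r - p)^2\<close>. The bound
    on \<open>\<beta>\<close> then lets the common factor \<open>1 - \<beta>^2\<close> cancel and
    gives \<open>N \<le> 1 - r * p\<close>, which is the collinear case of \<open>N\<close>.\<close>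
  then have "N\<^sup>2 * (1 - \<beta>\<^sup>2) = (1 - r * p)\<^sup>2 - (r - p)\<^sup>2"
    by (simp add: power2_eq_square algebra_simps)
  also have "\<dots> \<le> (1 - r * p)\<^sup>2 - (\<beta> * (1 - r * p))\<^sup>2"
    using power_mono[OF *, of 2] \<beta> rp by simp
  also have "\<dots> = (1 - r * p)\<^sup>2 * (1 - \<beta>\<^sup>2)"
    by (simp add: power2_eq_square algebra_simps)
  finally have "N\<^sup>2 \<le> (1 - r * p)\<^sup>2"
    using \<beta> by (simp add: abs_square_less_1)
  then have "N \<le> 1 - r * p"
    by (rule power2_le_imp_le) (use rp in simp)
  moreover have "1 - Re (cnj u * c) \<le> N"
    unfolding N_def using complex_Re_le_cmod[of "1 - cnj u * c"] by simp
  ultimately have "Re (cnj u * c) \<ge> cmod (cnj u * c)"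
    by (simp add: norm_mult p_def r_def mult.commute)
  then have "Re (cnj u * c) = cmod (cnj u * c)"
    using complex_Re_le_cmod[of "cnj u * c"] by simp
  moreover from this have "Im (cnj u * c) = 0"
    using cmod_power2[of "cnj u * c"] by simp
  ultimately have real: "cnj u * c = of_real (p * r)"
    by (simp add: complex_eq_iff norm_mult p_def r_def)
  obtain \<tau> where \<tau>: "0 \<le> \<tau>" "\<tau> \<le> 1" "u = of_real \<tau> * c"
  proof (cases "c = 0")
    case True
    then show ?thesis using \<open>p \<le> r\<close> by (intro that[of 0]) (auto simp: p_def r_def)
  next
    case False
    have "of_real (p / r) * c = u"
    proof -
      have "cnj (cnj u * c) = of_real (p * r)" unfolding real by simp
      then have "u * cnj c * c = of_real (p * r) * c" by simp
      then have "u * of_real (r\<^sup>2) = of_real (p * r) * c"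
        by (simp add: r_def complex_norm_square mult.assoc mult.commute[of "cnj c"] del: of_real_power)
      then show ?thesis using False by (simp add: r_def field_simps power2_eq_square)
    qed
    then show ?thesis
      using p r \<open>p \<le> r\<close> False by (intro that[of "p / r"]) (auto simp: r_def divide_simps)
  qed
  have "w = Moebius_function 0 (-a) u"
    unfolding u_def using assms by (subst Moebius_function_compose) auto
  then have "w = geodesic_arc a b \<tau>"
    by (simp add: geodesic_arc_def \<tau> c_def)
  then show ?thesis using \<tau> by (auto simp: path_image_def)
qed

lemma disc_path_endpoints:
  assumes "disc_path a b g"
  shows "cmod a < 1" "cmod b < 1"
  using assms pathstart_in_path_image[of g] pathfinish_in_path_image[of g]
  by (auto simp: disc_path_def)

definition geodesic_velocity :: "complex \<Rightarrow> complex \<Rightarrow> real \<Rightarrow> complex" where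
  "geodesic_velocity a b t =
     Moebius_function 0 a b * ((1 - (cmod a)\<^sup>2) / (1 + cnj a * (of_real t * Moebius_function 0 a b))\<^sup>2)"

context
  fixes a b :: complex
  assumes a: "cmod a < 1" and b: "cmod b < 1"
begin

lemma norm_Moebius_segment_lt_1:
  assumes "t \<in> {0..1::real}"
  shows "cmod (of_real t * Moebius_function 0 a b) < 1"
proof -
  have "cmod (of_real t * Moebius_function 0 a b) \<le> 1 * cmod (Moebius_function 0 a b)"
    unfolding norm_mult using assms by (intro mult_right_mono) auto
  also have "\<dots> < 1" using Moebius_function_norm_lt_1[OF a b] by simp
  finally show ?thesis .
qed

lemma norm_geodesic_arc_lt_1: "t \<in> {0..1} \<Longrightarrow> cmod (geodesic_arc a b t) < 1"
  unfolding geodesic_arc_def using a by (intro Moebius_function_norm_lt_1 norm_Moebius_segment_lt_1) auto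

lemma Moebius_geodesic_arc:
  "t \<in> {0..1} \<Longrightarrow> Moebius_function 0 a (geodesic_arc a b t) = of_real t * Moebius_function 0 a b"
  unfolding geodesic_arc_def using a by (intro Moebius_function_compose norm_Moebius_segment_lt_1) auto

lemma pathstart_geodesic_arc: "pathstart (geodesic_arc a b) = a"
  by (simp add: pathstart_def geodesic_arc_def Moebius_function_of_zero)

lemma pathfinish_geodesic_arc: "pathfinish (geodesic_arc a b) = b"
  unfolding pathfinish_def geodesic_arc_def using a b by (subst of_real_1, subst mult_1, subst Moebius_function_compose) auto

lemma geodesic_arc_has_vector_derivative:
  assumes "t \<in> {0..1}"
  shows "(geodesic_arc a b has_vector_derivative geodesic_velocity a b t) (at t)"
proof -
  have "((\<lambda>t. of_real t * Moebius_function 0 a b) has_vector_derivative Moebius_function 0 a b) (at t)"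
    by (auto intro!: derivative_eq_intros)
  from field_vector_diff_chain_at[OF this Moebius_function_has_field_derivative[of "-a"]] a norm_Moebius_segment_lt_1[OF assms]
  show ?thesis
    by (simp add: o_def geodesic_arc_def[abs_def] geodesic_velocity_def)
qed

lemma geodesic_arc_denominator_nonzero:
  assumes "t \<in> {0..1::real}"
  shows "1 + cnj a * (of_real t * Moebius_function 0 a b) \<noteq> 0"
  using one_minus_cnj_mult_nonzero[of "-a", OF _ norm_Moebius_segment_lt_1[OF assms]] a by simp

lemma continuous_on_geodesic_velocity: "continuous_on {0..1} (geodesic_velocity a b)"
  unfolding geodesic_velocity_def using geodesic_arc_denominator_nonzero by (intro continuous_intros) auto

lemma valid_path_geodesic_arc: "valid_path (geodesic_arc a b)"
  unfolding valid_path_def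
  by (intro C1_differentiable_imp_piecewise, unfold C1_differentiable_on_def)
     (use geodesic_arc_has_vector_derivative continuous_on_geodesic_velocity in blast)

lemma disc_path_geodesic_arc: "disc_path a b (geodesic_arc a b)"
  unfolding disc_path_def path_image_def
  using valid_path_geodesic_arc pathstart_geodesic_arc pathfinish_geodesic_arc norm_geodesic_arc_lt_1
  by auto

text \<open>The isometry reduces the arc to a radial segment, integrated by \<open>artanh\<close>.
  The value meets the general lower bound, so the arc is a minimizer against which any other
  geodesic can be compared.\<close>

lemma hyperbolic_length_geodesic_arc:
  "hyperbolic_length (geodesic_arc a b) = ennreal (2 * artanh (cmod (Moebius_function 0 a b)))"
proof -
  define c where "c = Moebius_function 0 a b"
  have c: "cmod c < 1" unfolding c_def by (rule Moebius_function_norm_lt_1[OF a b])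
  have ct: "\<bar>cmod c * t\<bar> < 1" if "t \<in> {0..1}" for t
    using norm_Moebius_segment_lt_1[OF that] by (simp add: c_def norm_mult abs_mult mult.commute)
  have "hyperbolic_length (geodesic_arc a b)
    = (\<integral>\<^sup>+t. ennreal (2 / (1 - (cmod c * t)\<^sup>2) * cmod c) * indicator {0..1} t \<partial>lborel)"
    unfolding hyperbolic_length_def
  proof (intro nn_integral_cong)
    fix t :: real
    show "ennreal (poincare_density (geodesic_arc a b t) * cmod (vector_derivative (geodesic_arc a b) (at t))) * indicator {0..1} t
      = ennreal (2 / (1 - (cmod c * t)\<^sup>2) * cmod c) * indicator {0..1} t"
    proof (cases "t \<in> {0..1}")
      case True
      have "cmod (vector_derivative (geodesic_arc a b) (at t)) = cmod c *
          cmod (complex_of_real (1 - (cmod (-a))\<^sup>2) / (1 - cnj (-a) * (of_real t * c))\<^sup>2)"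
        using vector_derivative_at[OF geodesic_arc_has_vector_derivative[OF True]]
        by (simp only: geodesic_velocity_def c_def norm_mult norm_minus_cancel complex_cnj_minus mult_minus_left diff_minus_eq_add)
      then have "poincare_density (geodesic_arc a b t) * cmod (vector_derivative (geodesic_arc a b) (at t))
        = cmod c * poincare_density (of_real t * c)"
        using poincare_density_Moebius[of "-a" "of_real t * c"] a norm_Moebius_segment_lt_1[OF True]
        by (simp add: geodesic_arc_def c_def)
      also have "poincare_density (of_real t * c) = 2 / (1 - (cmod c * t)\<^sup>2)"
        by (simp add: poincare_density_def norm_mult power_mult_distrib mult.commute)
      finally show ?thesis by (simp add: mult.commute)
    qed simp
  qed
  also have "\<dots> = ennreal (2 * artanh (cmod c * 1) - 2 * artanh (cmod c * 0))"
  proof (rule nn_integral_FTC_Icc)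
    fix t :: real assume t: "t \<in> {0..1}"
    have "((\<lambda>t. cmod c * t) has_real_derivative cmod c) (at t)"
      by (auto intro!: derivative_eq_intros)
    from DERIV_cmult[OF DERIV_chain2[OF artanh_real_has_field_derivative[OF ct[OF t]] this], of 2]
    show "((\<lambda>t. 2 * artanh (cmod c * t)) has_real_derivative 2 / (1 - (cmod c * t)\<^sup>2) * cmod c) (at t)"
      by simp
    show "0 \<le> 2 / (1 - (cmod c * t)\<^sup>2) * cmod c"
      using ct[OF t] by (intro mult_nonneg_nonneg divide_nonneg_nonneg) (auto simp: abs_square_le_1)
  qed auto
  finally show ?thesis by (simp add: c_def)
qed

text \<open>A point \<open>w\<close> of a minimizer splits it in two. Each half is at least as long
  as the distance of its end points, and together they are no longer than the arc, which is equality
  in the triangle inequality.\<close>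

lemma geodesic_path_image_subset:
  assumes "hyperbolic_geodesic a b h"
  shows "path_image h \<subseteq> path_image (geodesic_arc a b)"
proof
  fix w assume "w \<in> path_image h"
  then obtain s where s: "s \<in> {0..1}" "w = h s" by (auto simp: path_image_def)
  have hp: "disc_path a b h" and le: "hyperbolic_length h \<le> hyperbolic_length (geodesic_arc a b)"
    using assms disc_path_geodesic_arc by (auto simp: hyperbolic_geodesic_def)
  obtain T where T: "finite T" "h C1_differentiable_on ({0..1} - T)" and cont: "continuous_on {0..1} h"
    using hp by (auto simp: disc_path_def valid_path_def piecewise_C1_differentiable_on_def)
  \<comment> \<open>Removing \<open>s\<close> makes the two halves of the parameter interval disjoint.\<close>
  define S where "S = insert s T"
  have "finite S" using T by (simp add: S_def)
  have img: "h ` {0..1} \<subseteq> ball 0 1" and ends: "h 0 = a" "h 1 = b"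
    using hp by (auto simp: disc_path_def path_image_def pathstart_def pathfinish_def)
  define F where "F t = poincare_density (h t) * cmod (vector_derivative h (at t))" for t
  have sub: "{0..s} \<subseteq> {0..1}" "{s..1} \<subseteq> {0..1}" using s by auto
  note len1 = hyperbolic_distance_le_length[of 0 s S h, OF _ \<open>finite S\<close> continuous_on_subset[OF cont sub(1)]
      C1_differentiable_on_subset[OF T(2)] order_trans[OF image_mono[OF sub(1)] img], folded F_def]
  note len2 = hyperbolic_distance_le_length[of s 1 S h, OF _ \<open>finite S\<close> continuous_on_subset[OF cont sub(2)]
      C1_differentiable_on_subset[OF T(2)] order_trans[OF image_mono[OF sub(2)] img], folded F_def]
  have S1: "{0..s} - S \<subseteq> {0..1} - T" "{s..1} - S \<subseteq> {0..1} - T" using sub by (auto simp: S_def)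
  have w: "cmod w < 1" using img s by (auto simp: image_subset_iff)
  have nn: "artanh (cmod z) \<ge> 0" if "cmod z < 1" for z :: complex
    using that by (auto simp: artanh_def intro!: divide_nonneg_pos ln_ge_zero simp: divide_simps)
  have "ennreal (2 * artanh (cmod (Moebius_function 0 a w)) + 2 * artanh (cmod (Moebius_function 0 w b)))
    = ennreal (2 * artanh (cmod (Moebius_function 0 a w))) + ennreal (2 * artanh (cmod (Moebius_function 0 w b)))"
    using a b w by (intro ennreal_plus mult_nonneg_nonneg nn Moebius_function_norm_lt_1) auto
  also have "\<dots> \<le> (\<integral>\<^sup>+t. ennreal (indicator ({0..s} - S) t * F t) \<partial>lborel) + (\<integral>\<^sup>+t. ennreal (indicator ({s..1} - S) t * F t) \<partial>lborel)"
    using len1(1) len2(1) S1 s ends by (intro add_mono) auto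
  also have "\<dots> = (\<integral>\<^sup>+t. ennreal (indicator ({0..s} - S) t * F t) + ennreal (indicator ({s..1} - S) t * F t) \<partial>lborel)"
    using len1(2) len2(2) S1 s by (intro nn_integral_add[symmetric]) auto
  also have "\<dots> \<le> hyperbolic_length h"
    unfolding hyperbolic_length_def F_def[symmetric]
    using s by (intro nn_integral_mono) (auto simp: indicator_def S_def)
  also have "\<dots> \<le> ennreal (2 * artanh (cmod (Moebius_function 0 a b)))"
    using le by (simp add: hyperbolic_length_geodesic_arc)
  finally have "artanh (cmod (Moebius_function 0 a w)) + artanh (cmod (Moebius_function 0 w b)) \<le> artanh (cmod (Moebius_function 0 a b))"
    using nn[OF Moebius_function_norm_lt_1[OF a b]] by (subst (asm) ennreal_le_iff) auto
  then show "w \<in> path_image (geodesic_arc a b)"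
    by (rule hyperbolic_triangle_equality[OF a b w])
qed

text \<open>The Moebius map straightens the arc, so position along it is a continuous coordinate
  \<open>s\<close> with values in \<open>{0..1}\<close>, running from 0 to 1. A reparametrization of
  this kind is homotopic to the arc with fixed end points inside the arc itself, hence away from
  \<open>w\<close>.\<close>

lemma winding_number_geodesic:
  assumes h: "hyperbolic_geodesic a b h" and "a \<noteq> b" and w: "w \<notin> path_image (geodesic_arc a b)"
  shows "winding_number h w = winding_number (geodesic_arc a b) w"
proof -
  define c where "c = Moebius_function 0 a b"
  have "c \<noteq> 0"
    using \<open>a \<noteq> b\<close> one_minus_cnj_mult_nonzero[OF a b] by (simp add: c_def Moebius_function_simple)
  \<comment> \<open>\<open>h\<close> is the reparametrization of the arc by \<open>s\<close>, monotone or not.\<close>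
  define s where "s t = Re (Moebius_function 0 a (h t) / c)" for t
  have hp: "disc_path a b h" using h by (simp add: hyperbolic_geodesic_def)
  have ends: "h 0 = a" "h 1 = b"
    using hp by (auto simp: disc_path_def pathstart_def pathfinish_def)
  have s: "s t \<in> {0..1} \<and> h t = geodesic_arc a b (s t)" if t: "t \<in> {0..1}" for t
  proof -
    have "h t \<in> path_image (geodesic_arc a b)"
      using geodesic_path_image_subset[OF h] t by (auto simp: path_image_def)
    then obtain r where r: "r \<in> {0..1}" "h t = geodesic_arc a b r" by (auto simp: path_image_def)
    then have "s t = r"
      using Moebius_geodesic_arc[OF r(1)] \<open>c \<noteq> 0\<close> by (simp add: s_def c_def)
    then show ?thesis using r by simp
  qed
  have "continuous_on {0..1} h"
    using hp by (auto simp: disc_path_def intro: valid_path_imp_path[unfolded path_def])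
  moreover have "1 - cnj a * h t \<noteq> 0" if "t \<in> {0..1}" for t
    using one_minus_cnj_mult_nonzero[OF a, of "h t"] hp that by (auto simp: disc_path_def path_image_def image_subset_iff)
  ultimately have "continuous_on {0..1} s"
    unfolding s_def Moebius_function_simple using \<open>c \<noteq> 0\<close> by (intro continuous_intros) auto
  then have "homotopic_paths (- {w}) (geodesic_arc a b) h"
    using w s \<open>c \<noteq> 0\<close> valid_path_imp_path[OF valid_path_geodesic_arc]
    by (intro homotopic_paths_reparametrize[where f = s])
       (auto simp: s_def ends Moebius_function_eq_zero c_def[symmetric])
  then show ?thesis by (rule winding_number_homotopic_paths[symmetric])
qed

end

section \<open>The line integral along a geodesic\<close>

text \<open>\<open>V\<close> is the weighted winding number redefined on the path itself, where \<^const>\<open>winding_number\<close>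
  is unspecified and need not be Borel measurable.\<close>
lemma winding_number_weighted_integral:
  fixes \<gamma> \<gamma>' :: "real \<Rightarrow> complex"
  assumes "valid_path \<gamma>" and d: "\<And>t. t \<in> {0..1} \<Longrightarrow> (\<gamma> has_vector_derivative \<gamma>' t) (at t)"
    and cont: "continuous_on {0..1} \<gamma>'" and R: "path_image \<gamma> \<subseteq> ball 0 R" "R < 1"
  obtains V where "integrable lborel V"
    "(\<integral>w. V w \<partial>lborel) = 4 * pi / (2 * pi * \<i>) * integral {0..1} (\<lambda>t. cnj (\<gamma> t) / (1 - (cmod (\<gamma> t))\<^sup>2) * \<gamma>' t)"
    "\<And>w. w \<notin> path_image \<gamma> \<Longrightarrow> V w = complex_of_real (indicator (ball 0 R) w * (poincare_density w)\<^sup>2) * winding_number \<gamma> w"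
proof
  define \<phi> where "\<phi> w = indicator (ball 0 R) w * (poincare_density w)\<^sup>2" for w :: complex
  have \<phi>m [measurable]: "\<phi> \<in> borel_measurable borel"
    unfolding \<phi>_def by (intro measurable_indicator_density) simp
  have path: "continuous_on {0..1} \<gamma>" using valid_path_imp_path[OF \<open>valid_path \<gamma>\<close>] by (simp add: path_def)
  have nR: "cmod (\<gamma> t) < R" if "t \<in> {0..1}" for t using R that by (auto simp: path_image_def image_subset_iff)
  \<comment> \<open>Extension by zero makes the curve and its velocity Borel on the whole line;
    \<open>G' = 0\<close> outside \<open>{0..1}\<close> keeps the integrals unchanged.\<close>
  define G where "G t = indicator {0..1} t *\<^sub>R \<gamma> t" for t
  define G' where "G' t = indicator {0..1} t *\<^sub>R \<gamma>' t" for t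
  have Gm [measurable]: "G \<in> borel_measurable borel" unfolding G_def
    by (intro borel_measurable_continuous_on_indicator path) auto
  have G'm [measurable]: "G' \<in> borel_measurable borel" unfolding G'_def
    by (intro borel_measurable_continuous_on_indicator cont) auto
  define K where "K t w = complex_of_real (\<phi> w) / (G t - w) * G' t" for t w
  have Km [measurable]: "case_prod K \<in> borel_measurable (lborel \<Otimes>\<^sub>M lborel)"
    unfolding K_def split_def by measurable
  define C where "C = ennreal ((2 / (1 - R\<^sup>2))\<^sup>2 * (4 * pi))"
  have int: "integrable (lborel \<Otimes>\<^sub>M lborel) (case_prod K)"
  proof (rule integrableI_bounded)
    have "bounded (\<gamma>' ` {0..1})"
      by (intro compact_imp_bounded compact_continuous_image cont) simp
    then obtain B where B: "\<And>t. t \<in> {0..1} \<Longrightarrow> cmod (\<gamma>' t) \<le> B"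
      by (metis bounded_iff imageI)
    have "(\<integral>\<^sup>+x. ennreal (cmod (case_prod K x)) \<partial>(lborel \<Otimes>\<^sub>M lborel)) = (\<integral>\<^sup>+t. \<integral>\<^sup>+w. ennreal (cmod (K t w)) \<partial>lborel \<partial>lborel)"
      by (subst lborel.nn_integral_fst[symmetric]) (auto simp: split_def)
    also have "\<dots> \<le> (\<integral>\<^sup>+t. C * ennreal B * indicator {0..1::real} t \<partial>lborel)"
    proof (rule nn_integral_mono)
      fix t :: real
      show "(\<integral>\<^sup>+w. ennreal (cmod (K t w)) \<partial>lborel) \<le> C * ennreal B * indicator {0..1} t"
      proof (cases "t \<in> {0..1}")
        case True
        have "(\<integral>\<^sup>+w. ennreal (cmod (K t w)) \<partial>lborel)
          = (\<integral>\<^sup>+w. ennreal (cmod (complex_of_real (\<phi> w) / (\<gamma> t - w))) * ennreal (cmod (\<gamma>' t)) \<partial>lborel)"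
          using True by (intro nn_integral_cong) (simp add: K_def G_def G'_def flip: norm_mult ennreal_mult)
        also have "\<dots> = (\<integral>\<^sup>+w. ennreal (cmod (complex_of_real (\<phi> w) / (\<gamma> t - w))) \<partial>lborel) * ennreal (cmod (\<gamma>' t))"
          by (rule nn_integral_multc) measurable
        also have "\<dots> \<le> C * ennreal B"
          unfolding C_def \<phi>_def using R nR[OF True]
          by (intro mult_mono nn_integral_cauchy_kernel_le ennreal_leI B True) auto
        finally show ?thesis using True by simp
      qed (simp add: K_def G'_def)
    qed
    also have "\<dots> < \<infinity>"
      by (simp add: nn_integral_cmult C_def ennreal_mult_less_top)
    finally show "(\<integral>\<^sup>+x. ennreal (cmod (case_prod K x)) \<partial>(lborel \<Otimes>\<^sub>M lborel)) < \<infinity>" .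
  qed fact
  \<comment> \<open>The Cauchy integral for the winding number, now meaningful as an integral for
    every \<open>w\<close>. Integrated over \<open>w\<close> first, it yields the Cauchy transform
    at \<open>\<gamma> t\<close>.\<close>
  define V where "V w = 1 / (2 * pi * \<i>) * (\<integral>t. K t w \<partial>lborel)" for w
  show "integrable lborel V"
    unfolding V_def by (intro integrable_mult_right lborel_pair.integrable_snd[OF int])
  have "(\<integral>w. V w \<partial>lborel) = 1 / (2 * pi * \<i>) * (\<integral>w. \<integral>t. K t w \<partial>lborel \<partial>lborel)"
    unfolding V_def by (rule integral_mult_right_zero)
  also have "(\<integral>w. \<integral>t. K t w \<partial>lborel \<partial>lborel) = (\<integral>t. \<integral>w. K t w \<partial>lborel \<partial>lborel)"
    by (rule lborel_pair.Fubini_integral[OF int])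
  also have "\<dots> = (LINT t:{0..1}|lborel. 4 * pi * (cnj (\<gamma> t) / (1 - (cmod (\<gamma> t))\<^sup>2) * \<gamma>' t))"
    unfolding set_lebesgue_integral_def
  proof (rule Bochner_Integration.integral_cong)
    fix t :: real
    show "(\<integral>w. K t w \<partial>lborel) = indicat_real {0..1} t *\<^sub>R (4 * pi * (cnj (\<gamma> t) / (1 - (cmod (\<gamma> t))\<^sup>2) * \<gamma>' t))"
    proof (cases "t \<in> {0..1}")
      case True
      have "(\<integral>w. K t w \<partial>lborel) = (\<integral>w. complex_of_real (\<phi> w) / (\<gamma> t - w) \<partial>lborel) * \<gamma>' t"
      proof -
        have "K t w = complex_of_real (\<phi> w) / (\<gamma> t - w) * \<gamma>' t" for w
          using True by (simp add: K_def G_def G'_def)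
        then show ?thesis by (simp only: integral_mult_left_zero)
      qed
      also have "\<dots> = 4 * pi * cnj (\<gamma> t) / (1 - (cmod (\<gamma> t))\<^sup>2) * \<gamma>' t"
        unfolding \<phi>_def by (subst cauchy_transform_hyperbolic_area[OF nR[OF True] R(2)]) simp
      finally show ?thesis using True by simp
    qed (simp add: K_def G'_def)
  qed simp
  also have "\<dots> = 4 * pi * (LINT t:{0..1}|lborel. cnj (\<gamma> t) / (1 - (cmod (\<gamma> t))\<^sup>2) * \<gamma>' t)"
    by (rule set_integral_mult_right)
  also have "(LINT t:{0..1}|lborel. cnj (\<gamma> t) / (1 - (cmod (\<gamma> t))\<^sup>2) * \<gamma>' t)
      = integral {0..1} (\<lambda>t. cnj (\<gamma> t) / (1 - (cmod (\<gamma> t))\<^sup>2) * \<gamma>' t)"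
  proof (rule set_borel_integral_eq_integral(2))
    have "1 - (cmod (\<gamma> t))\<^sup>2 \<noteq> 0" if "t \<in> {0..1}" for t
      using nR[OF that] R by (simp add: abs_square_eq_1)
    then have "1 - complex_of_real ((cmod (\<gamma> t))\<^sup>2) \<noteq> 0" if "t \<in> {0..1}" for t
      using that by (metis of_real_1 of_real_diff of_real_eq_0_iff)
    then show "set_integrable lborel {0..1} (\<lambda>t. cnj (\<gamma> t) / (1 - (cmod (\<gamma> t))\<^sup>2) * \<gamma>' t)"
      unfolding set_integrable_def
      by (intro borel_integrable_compact continuous_intros path cont) auto
  qed
  finally show "(\<integral>w. V w \<partial>lborel) = 4 * pi / (2 * pi * \<i>) * integral {0..1} (\<lambda>t. cnj (\<gamma> t) / (1 - (cmod (\<gamma> t))\<^sup>2) * \<gamma>' t)"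
    by simp
  fix w assume w: "w \<notin> path_image \<gamma>"
  have nz: "\<gamma> t - w \<noteq> 0" if "t \<in> {0..1}" for t using w that by (auto simp: path_image_def)
  have "winding_number \<gamma> w = 1 / (2 * pi * \<i>) * integral {0..1} (\<lambda>t. 1 / (\<gamma> t - w) * vector_derivative \<gamma> (at t))"
    using winding_number_valid_path[OF \<open>valid_path \<gamma>\<close> w] by (simp add: contour_integral_integral)
  also have "integral {0..1} (\<lambda>t. 1 / (\<gamma> t - w) * vector_derivative \<gamma> (at t)) = integral {0..1} (\<lambda>t. 1 / (\<gamma> t - w) * \<gamma>' t)"
    using vector_derivative_at[OF d] by (intro Henstock_Kurzweil_Integration.integral_cong) simp
  also have "\<dots> = (LINT t:{0..1}|lborel. 1 / (\<gamma> t - w) * \<gamma>' t)"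
  proof (rule set_borel_integral_eq_integral(2)[symmetric])
    show "set_integrable lborel {0..1} (\<lambda>t. 1 / (\<gamma> t - w) * \<gamma>' t)"
      unfolding set_integrable_def using nz
      by (intro borel_integrable_compact continuous_intros path cont) auto
  qed
  finally have W: "winding_number \<gamma> w = 1 / (2 * pi * \<i>) * (LINT t:{0..1}|lborel. 1 / (\<gamma> t - w) * \<gamma>' t)" .
  have "(\<integral>t. K t w \<partial>lborel) = complex_of_real (\<phi> w) * (LINT t:{0..1}|lborel. 1 / (\<gamma> t - w) * \<gamma>' t)"
    unfolding set_lebesgue_integral_def integral_mult_right_zero[symmetric]
    by (intro Bochner_Integration.integral_cong) (auto simp: K_def G_def G'_def indicator_def)
  then show "V w = complex_of_real (indicator (ball 0 R) w * (poincare_density w)\<^sup>2) * winding_number \<gamma> w"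
    unfolding V_def W \<phi>_def[symmetric] by simp
qed

lemma Im_integral_geodesic_arc:
  assumes a: "cmod a < 1" and b: "cmod b < 1"
  shows "Im (integral {0..1} (\<lambda>t. cnj (geodesic_arc a b t) / (1 - (cmod (geodesic_arc a b t))\<^sup>2) * geodesic_velocity a b t))
    = arctan (Im (cnj a * b) / (1 - Re (cnj a * b)))"
proof -
  define c where "c = Moebius_function 0 a b"
  define p where "p = cnj a * c"
  define k where "k = (cmod c)\<^sup>2"
  have c: "cmod c < 1" unfolding c_def by (rule Moebius_function_norm_lt_1[OF a b])
  have k: "k * t\<^sup>2 < 1" if "t \<in> {0..1}" for t
  proof -
    have "(cmod (of_real t * c))\<^sup>2 < 1"
      using norm_Moebius_segment_lt_1[OF a b that] unfolding abs_square_less_1 c_def by simp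
    then show ?thesis by (simp add: k_def norm_mult power_mult_distrib mult.commute)
  qed
  have p: "Re (1 + p * of_real t) > 0" if "t \<in> {0..1}" for t
  proof -
    have "cmod (p * of_real t) = cmod a * cmod (of_real t * c)"
      by (simp add: p_def norm_mult)
    also have "\<dots> < 1 * 1"
      using a norm_Moebius_segment_lt_1[OF a b that] by (intro mult_strict_mono') (auto simp: c_def)
    finally show ?thesis
      using abs_Re_le_cmod[of "p * of_real t"] by simp
  qed
  \<comment> \<open>Partial fractions of \<open>(k t + p) / ((1 + p t) (1 - k t\<^sup>2))\<close>; the second summand is real.\<close>
  have J: "cnj (geodesic_arc a b t) / (1 - (cmod (geodesic_arc a b t))\<^sup>2) * geodesic_velocity a b t
     = p / (1 + p * of_real t) + of_real (k * t / (1 - k * t\<^sup>2))" if t: "t \<in> {0..1}" for t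
  proof -
    define D where "D = 1 + p * of_real t"
    have D: "D \<noteq> 0" using p[OF t] unfolding D_def by (metis zero_complex.sel(1) less_irrefl)
    have D': "D = 1 - cnj (-a) * (of_real t * c)" by (simp add: D_def p_def)
    define s where "s = 1 - (cmod a)\<^sup>2"
    have s: "s > 0" using a by (simp add: s_def abs_square_less_1)
    define m where "m = 1 - k * t\<^sup>2"
    have m: "m > 0" using k[OF t] by (simp add: m_def)
    have 1: "geodesic_arc a b t = (of_real t * c + a) / D"
      unfolding geodesic_arc_def Moebius_function_simple[of "-a"] D' c_def by simp
    have 2: "geodesic_velocity a b t = c * (of_real s / D\<^sup>2)"
      unfolding geodesic_velocity_def s_def D_def p_def c_def by (simp add: mult_ac)
    have "1 - (cmod (geodesic_arc a b t))\<^sup>2 = s * m / (cmod D)\<^sup>2"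
      using one_minus_norm_Moebius[of "-a" "of_real t * c"] a norm_Moebius_segment_lt_1[OF a b t]
      unfolding geodesic_arc_def D' s_def m_def k_def c_def
      by (simp add: norm_mult power_mult_distrib mult.commute)
    then have 3: "complex_of_real (1 - (cmod (geodesic_arc a b t))\<^sup>2) = of_real s * of_real m / (D * cnj D)"
      by (simp add: complex_norm_square[symmetric])
    have kk: "complex_of_real k = c * cnj c" by (simp add: k_def complex_norm_square[symmetric])
    have "cnj (geodesic_arc a b t) / complex_of_real (1 - (cmod (geodesic_arc a b t))\<^sup>2) * geodesic_velocity a b t
      = (cnj (of_real t * c + a) / cnj D) / (of_real s * of_real m / (D * cnj D)) * (c * (of_real s / D\<^sup>2))"
      unfolding 3 unfolding 1 2 by simp
    also have "\<dots> = (of_real k * of_real t + p) / (D * of_real m)"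
      using D s m by (simp add: divide_simps kk p_def power2_eq_square) (simp add: algebra_simps)
    also have "\<dots> = p / D + of_real (k * t) / of_real m"
    proof -
      have "p * of_real m + of_real (k * t) * D = of_real k * of_real t + p"
        by (simp add: m_def D_def algebra_simps power2_eq_square)
      then show ?thesis using D m by (simp add: add_frac_eq mult.commute)
    qed
    finally show ?thesis by (simp add: D_def m_def)
  qed
  \<comment> \<open>\<open>1 + p * t\<close> stays in the right half-plane, away from the branch
    cut, so \<open>Ln\<close> is a genuine primitive. The second summand is real and disappears
    under \<open>Im\<close>.\<close>
  define F where "F t = Ln (1 + p * of_real t) + of_real (- (ln (1 - k * t\<^sup>2) / 2))" for t
  have "((\<lambda>t. p / (1 + p * of_real t) + of_real (k * t / (1 - k * t\<^sup>2))) has_integral (F 1 - F 0)) {0..1}"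
  proof (rule fundamental_theorem_of_calculus)
    fix t :: real assume t: "t \<in> {0..1}"
    have "1 + p * of_real t \<notin> \<real>\<^sub>\<le>\<^sub>0" using p[OF t] by (auto simp: complex_nonpos_Reals_iff)
    moreover have "((\<lambda>t. 1 + p * complex_of_real t) has_vector_derivative p) (at t)"
      by (auto intro!: derivative_eq_intros)
    ultimately have "((\<lambda>t. Ln (1 + p * of_real t)) has_vector_derivative p * inverse (1 + p * of_real t)) (at t)"
      using field_vector_diff_chain_at[of _ p t Ln, OF _ has_field_derivative_Ln] by (auto simp: o_def)
    moreover have "((\<lambda>t. - (ln (1 - k * t\<^sup>2) / 2)) has_real_derivative k * t / (1 - k * t\<^sup>2)) (at t)"
      using k[OF t] by (auto intro!: derivative_eq_intros simp: divide_simps)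
    then have "((\<lambda>t. complex_of_real (- (ln (1 - k * t\<^sup>2) / 2))) has_vector_derivative of_real (k * t / (1 - k * t\<^sup>2))) (at t)"
      by (intro has_vector_derivative_of_real) (simp add: has_real_derivative_iff_has_vector_derivative)
    ultimately have "(F has_vector_derivative p * inverse (1 + p * of_real t) + of_real (k * t / (1 - k * t\<^sup>2))) (at t)"
      unfolding F_def by (rule has_vector_derivative_add)
    then show "(F has_vector_derivative p / (1 + p * of_real t) + of_real (k * t / (1 - k * t\<^sup>2))) (at t within {0..1})"
      by (simp add: divide_inverse has_vector_derivative_at_within)
  qed simp
  then have "integral {0..1} (\<lambda>t. cnj (geodesic_arc a b t) / (1 - (cmod (geodesic_arc a b t))\<^sup>2) * geodesic_velocity a b t) = F 1 - F 0"
    using J by (subst Henstock_Kurzweil_Integration.integral_cong[OF J]) (auto simp: integral_unique)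
  then have "Im (integral {0..1} (\<lambda>t. cnj (geodesic_arc a b t) / (1 - (cmod (geodesic_arc a b t))\<^sup>2) * geodesic_velocity a b t))
     = Im (Ln (1 + p))"
    by (simp add: F_def)
  \<comment> \<open>In the right half-plane the argument is the principal arctangent of the slope,
    without correction by \<open>pi\<close>.\<close>
  also have "\<dots> = arctan (Im (1 + p) / Re (1 + p))"
  proof -
    have "1 + p \<noteq> 0" using p[of 1] by (auto simp: complex_eq_iff)
    then show ?thesis using p[of 1] Im_Ln_eq[of "1 + p"] by simp
  qed
  \<comment> \<open>A positive multiple of the inverse of \<open>1 - cnj a * b\<close>; inversion
    negates the slope, which turns \<open>- Im (cnj a * b)\<close> into
    \<open>Im (cnj a * b)\<close>.\<close>
  also have "1 + p = complex_of_real (1 - (cmod a)\<^sup>2) / (1 - cnj a * b)"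
    using one_minus_cnj_mult_nonzero[OF a b]
    by (simp add: p_def c_def Moebius_function_simple complex_norm_square divide_simps del: of_real_power) (simp add: algebra_simps)
  also have "Im (complex_of_real (1 - (cmod a)\<^sup>2) / (1 - cnj a * b)) / Re (complex_of_real (1 - (cmod a)\<^sup>2) / (1 - cnj a * b))
     = Im (cnj a * b) / (1 - Re (cnj a * b))"
  proof -
    have 1: "1 - (cmod a)\<^sup>2 \<noteq> 0" using a by (simp add: abs_square_eq_1)
    have "Im (of_real s / q) / Re (of_real s / q) = - Im q / Re q" if "s \<noteq> 0" "q \<noteq> 0" for s :: real and q :: complex
      using that by (simp add: Im_divide Re_divide complex_neq_0)
    from this[OF 1 one_minus_cnj_mult_nonzero[OF a b]] show ?thesis by simp
  qed
  finally show ?thesis .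
qed

section \<open>Polygons\<close>

text \<open>Winding numbers of consecutive subpaths add although the sides are not closed, and each
  side may then be exchanged for its explicit arc. The inclusion ensures that a point off all arcs
  is off the curve.\<close>

lemma hyperbolic_polygon_boundary_winding_number:
  assumes g: "hyperbolic_polygon_boundary n z g" and "n \<ge> 1"
    and ne: "\<And>k. k \<in> {1..n} \<Longrightarrow> z k \<noteq> z (k + 1)"
  shows "path_image g \<subseteq> (\<Union>k\<in>{1..n}. path_image (geodesic_arc (z k) (z (k + 1))))"
    and "w \<notin> (\<Union>k\<in>{1..n}. path_image (geodesic_arc (z k) (z (k + 1)))) \<Longrightarrow>
      winding_number g w = (\<Sum>k = 1..n. winding_number (geodesic_arc (z k) (z (k + 1))) w)"
proof -
  obtain t where t: "t 1 = 0" "t (n + 1) = 1" "strict_mono_on {1..n + 1} t"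
    and geo: "\<And>k. k \<in> {1..n} \<Longrightarrow> hyperbolic_geodesic (z k) (z (k + 1)) (subpath (t k) (t (k + 1)) g)"
    using g by (auto simp: hyperbolic_polygon_boundary_def)
  have "path g" using g by (simp add: hyperbolic_polygon_boundary_def simple_path_imp_path)
  have mono: "t j \<le> t k" if "1 \<le> j" "j \<le> k" "k \<le> n + 1" for j k
    using strict_mono_on_leD[OF t(3), of j k] that by simp
  have t01: "t k \<in> {0..1}" if "1 \<le> k" "k \<le> n + 1" for k
    using mono[of 1 k] mono[of k "n + 1"] that t by simp
  have disc: "cmod (z k) < 1" "cmod (z (k + 1)) < 1" if "k \<in> {1..n}" for k
    using geo[OF that] disc_path_endpoints unfolding hyperbolic_geodesic_def by blast+
  have sub: "g ` {t k..t (k + 1)} \<subseteq> path_image (geodesic_arc (z k) (z (k + 1)))" if k: "k \<in> {1..n}" for k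
    using geodesic_path_image_subset[OF disc[OF k] geo[OF k]] mono[of k "k + 1"] k
    by (simp add: path_image_subpath)
  have cover: "{t 1..t (m + 1)} \<subseteq> (\<Union>k\<in>{1..m}. {t k..t (k + 1)})" if "1 \<le> m" for m
    using that
  proof (induction m rule: nat_induct_at_least)
    case (Suc m)
    have "{t 1..t (Suc m + 1)} \<subseteq> {t 1..t (m + 1)} \<union> {t (Suc m)..t (Suc m + 1)}" by auto
    also have "\<dots> \<subseteq> (\<Union>k\<in>{1..m}. {t k..t (k + 1)}) \<union> {t (Suc m)..t (Suc m + 1)}"
      using Suc.IH by blast
    also have "\<dots> \<subseteq> (\<Union>k\<in>{1..Suc m}. {t k..t (k + 1)})" by fastforce
    finally show ?case .
  qed auto
  show img: "path_image g \<subseteq> (\<Union>k\<in>{1..n}. path_image (geodesic_arc (z k) (z (k + 1))))"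
  proof -
    have "path_image g \<subseteq> g ` (\<Union>k\<in>{1..n}. {t k..t (k + 1)})"
      unfolding path_image_def using cover[OF \<open>n \<ge> 1\<close>] t by (intro image_mono) simp
    also have "\<dots> \<subseteq> (\<Union>k\<in>{1..n}. path_image (geodesic_arc (z k) (z (k + 1))))"
      unfolding image_UN using sub by (intro UN_mono) auto
    finally show ?thesis .
  qed
  assume w: "w \<notin> (\<Union>k\<in>{1..n}. path_image (geodesic_arc (z k) (z (k + 1))))"
  then have wg: "w \<notin> path_image g" using img by blast
  have "winding_number (subpath (t 1) (t (m + 1)) g) w = (\<Sum>k = 1..m. winding_number (subpath (t k) (t (k + 1)) g) w)"
    if "m \<ge> 1" "m \<le> n" for m
    using that
  proof (induction m rule: nat_induct_at_least)
    case (Suc m)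
    have "winding_number (subpath (t 1) (t (Suc m + 1)) g) w
      = winding_number (subpath (t 1) (t (m + 1)) g) w + winding_number (subpath (t (m + 1)) (t (Suc m + 1)) g) w"
      using Suc.prems by (intro winding_number_subpath_combine[symmetric] \<open>path g\<close> wg t01) auto
    then show ?case using Suc by simp
  qed simp
  from this[of n] have "winding_number g w = (\<Sum>k = 1..n. winding_number (subpath (t k) (t (k + 1)) g) w)"
    using \<open>n \<ge> 1\<close> t by simp
  also have "\<dots> = (\<Sum>k = 1..n. winding_number (geodesic_arc (z k) (z (k + 1))) w)"
    using w by (intro sum.cong refl winding_number_geodesic disc geo ne) auto
  finally show "winding_number g w = (\<Sum>k = 1..n. winding_number (geodesic_arc (z k) (z (k + 1))) w)" .
qed

text \<open>A differentiable image of an interval is null in the plane, so whatever the weighted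
  winding numbers do on the sides is invisible to the area.\<close>

lemma AE_not_in_geodesic_arc:
  assumes "cmod a < 1" "cmod b < 1"
  shows "AE w in lborel. w \<notin> path_image (geodesic_arc a b)"
proof (rule AE_not_in)
  have "geodesic_arc a b differentiable_on {0..1}"
    using geodesic_arc_has_vector_derivative[OF assms]
    unfolding differentiable_on_def by (blast intro: differentiableI_vector differentiable_at_withinI)
  then have "negligible (path_image (geodesic_arc a b))"
    unfolding path_image_def by (intro negligible_differentiable_image_lowdim) auto
  moreover have "path_image (geodesic_arc a b) \<in> sets borel"
    by (intro borel_closed closed_path_image valid_path_imp_path valid_path_geodesic_arc assms)
  ultimately show "path_image (geodesic_arc a b) \<in> null_sets lborel"
    by (simp add: negligible_iff_null_sets null_sets_completion_iff)
qed

text \<open>Provides the radius \<open>R < 1\<close> below which the Poincare density is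
  bounded.\<close>

lemma compact_subset_smaller_ball:
  assumes "compact U" "U \<subseteq> ball (0::complex) 1"
  obtains R where "0 < R" "R < 1" "U \<subseteq> ball 0 R"
proof (cases "U = {}")
  case True
  then show ?thesis using that[of "1/2"] by simp
next
  case False
  obtain v where v: "v \<in> U" "\<And>u. u \<in> U \<Longrightarrow> cmod u \<le> cmod v"
    using continuous_attains_sup[OF assms(1) False, of cmod] by (auto intro: continuous_intros)
  then have "cmod v < 1" using assms by auto
  then obtain R where R: "cmod v < R" "R < 1" using dense by blast
  have "U \<subseteq> ball 0 R" using le_less_trans[OF v(2) R(1)] by auto
  then show ?thesis
    using R le_less_trans[OF norm_ge_zero R(1)] by (intro that[of R])
qed

theorem mainTheorem1:
  fixes n :: nat and x y :: "nat \<Rightarrow> real" and g :: "real \<Rightarrow> complex"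
  assumes "n \<ge> 3"
    and "\<And>k. k \<in> {1..n} \<Longrightarrow> (x k)\<^sup>2 + (y k)\<^sup>2 < 1"
    and "x (n + 1) = x 1" and "y (n + 1) = y 1"
    and "\<And>k. k \<in> {1..n} \<Longrightarrow> (x k, y k) \<noteq> (x (k + 1), y (k + 1))"
    and "hyperbolic_polygon_boundary n (\<lambda>k. Complex (x k) (y k)) g"
    and "positively_oriented g"
  shows "hyperbolic_area (inside (path_image g)) =
    (\<Sum>k = 1..n. 2 * arctan ((x k * y (k + 1) - y k * x (k + 1)) /
                              (1 - x k * x (k + 1) - y k * y (k + 1))))"
proof -
  define z where "z k = Complex (x k) (y k)" for k
  define \<gamma> where "\<gamma> k = geodesic_arc (z k) (z (k + 1))" for k
  define U where "U = (\<Union>k\<in>{1..n}. path_image (\<gamma> k))"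
  have bd: "hyperbolic_polygon_boundary n z g" using assms(6) by (simp add: z_def[abs_def])
  have zne: "z k \<noteq> z (k + 1)" if "k \<in> {1..n}" for k using assms(5)[OF that] by (simp add: z_def)
  have zk: "cmod (z k) < 1" if "k \<in> {1..n}" for k
    using assms(2)[OF that] by (simp add: z_def complex_norm)
  \<comment> \<open>The index \<open>n + 1\<close> lies outside the hypothesis on the vertices and
    is wrapped around to vertex 1.\<close>
  have zk1: "cmod (z (k + 1)) < 1" if "k \<in> {1..n}" for k
  proof (cases "k = n")
    case True
    then show ?thesis using zk[of 1] assms(1,3,4) by (simp add: z_def)
  qed (use zk[of "k + 1"] that in auto)
  have gU: "path_image g \<subseteq> U"
    using hyperbolic_polygon_boundary_winding_number(1)[OF bd _ zne] assms(1) by (simp add: U_def \<gamma>_def)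
  have Wsum: "winding_number g w = (\<Sum>k = 1..n. winding_number (\<gamma> k) w)" if "w \<notin> U" for w
    using hyperbolic_polygon_boundary_winding_number(2)[OF bd _ zne] assms(1) that unfolding U_def \<gamma>_def by simp
  have "compact U"
    unfolding U_def \<gamma>_def by (intro compact_UN compact_path_image valid_path_imp_path valid_path_geodesic_arc zk zk1) auto
  moreover have "U \<subseteq> ball 0 1"
    using disc_path_geodesic_arc[OF zk zk1] unfolding U_def \<gamma>_def disc_path_def by blast
  ultimately obtain R where R: "0 < R" "R < 1" "U \<subseteq> ball 0 R"
    by (rule compact_subset_smaller_ball)
  define \<phi> where "\<phi> w = indicator (ball 0 R) w * (poincare_density w)\<^sup>2" for w :: complex
  define J where "J k = integral {0..1} (\<lambda>t. cnj (\<gamma> k t) / (1 - (cmod (\<gamma> k t))\<^sup>2) * geodesic_velocity (z k) (z (k + 1)) t)" for k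
  \<comment> \<open>The winding number of a single open arc need not be an integer, or even real, so
    one summand has no geometric meaning. Only the sum over the closed polygon is the indicator of
    its interior, weighted by the squared density.\<close>
  have "\<exists>V. integrable lborel V \<and> (\<integral>w. V w \<partial>lborel) = 4 * pi / (2 * pi * \<i>) * J k \<and>
      (\<forall>w. w \<notin> path_image (\<gamma> k) \<longrightarrow> V w = complex_of_real (\<phi> w) * winding_number (\<gamma> k) w)" if k: "k \<in> {1..n}" for k
  proof -
    have "path_image (\<gamma> k) \<subseteq> ball 0 R" using R(3) k unfolding U_def by blast
    from winding_number_weighted_integral[OF valid_path_geodesic_arc[OF zk[OF k] zk1[OF k]] geodesic_arc_has_vector_derivative[OF zk[OF k] zk1[OF k]]
        continuous_on_geodesic_velocity[OF zk[OF k] zk1[OF k]] this[unfolded \<gamma>_def] R(2)]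
    show ?thesis unfolding J_def \<phi>_def \<gamma>_def by blast
  qed
  then obtain V where V: "\<And>k. k \<in> {1..n} \<Longrightarrow> integrable lborel (V k)"
    "\<And>k. k \<in> {1..n} \<Longrightarrow> (\<integral>w. V k w \<partial>lborel) = 4 * pi / (2 * pi * \<i>) * J k"
    "\<And>k w. k \<in> {1..n} \<Longrightarrow> w \<notin> path_image (\<gamma> k) \<Longrightarrow> V k w = complex_of_real (\<phi> w) * winding_number (\<gamma> k) w"
    by metis
  define P where "P = path_image g"
  have g: "path g" "pathfinish g = pathstart g"
    using bd by (auto simp: hyperbolic_polygon_boundary_def simple_path_imp_path)
  have "closed P" unfolding P_def by (intro closed_path_image g)
  then have inP: "inside P \<in> sets borel" by (intro borel_open open_inside)
  \<comment> \<open>A convex set containing the curve has its complement in the outside; so the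
    cutoff in \<open>\<phi>\<close> loses nothing of the polygon.\<close>
  have "- ball 0 R \<subseteq> outside P"
    using outside_subset_convex[of "ball 0 R" P] gU R(3) by (simp add: P_def)
  then have inR: "inside P \<subseteq> ball 0 R"
    using inside_Int_outside[of P] by blast
  have winding: "winding_number g w = indicator (inside P) w" if "w \<notin> P" for w
  proof (cases "w \<in> inside P")
    case True
    then show ?thesis using assms(7) by (simp add: positively_oriented_def P_def)
  next
    case False
    then have "w \<in> outside P" using False that inside_outside[of P] by blast
    then show ?thesis using winding_number_zero_in_outside[of g w] g False by (simp add: P_def)
  qed
  have "AE w in lborel. \<forall>k\<in>{1..n}. w \<notin> path_image (\<gamma> k)"
    unfolding \<gamma>_def by (intro AE_finite_allI AE_not_in_geodesic_arc zk zk1) auto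
  then have AE: "AE w in lborel. complex_of_real (indicator (inside P) w * (poincare_density w)\<^sup>2) = (\<Sum>k = 1..n. V k w)"
  proof eventually_elim
    case (elim w)
    then have "w \<notin> U" by (auto simp: U_def)
    have "(\<Sum>k = 1..n. V k w) = complex_of_real (\<phi> w) * winding_number g w"
      using elim by (simp add: Wsum[OF \<open>w \<notin> U\<close>] sum_distrib_left V(3))
    also have "\<dots> = complex_of_real (indicator (inside P) w * (poincare_density w)\<^sup>2)"
    proof -
      have "w \<notin> P" using gU \<open>w \<notin> U\<close> by (auto simp: P_def)
      from winding[OF this] show ?thesis using inR by (auto simp: \<phi>_def indicator_def)
    qed
    finally show ?case ..
  qed
  have "complex_of_real (hyperbolic_area (inside P)) = (\<integral>w. complex_of_real (indicator (inside P) w * (poincare_density w)\<^sup>2) \<partial>lborel)"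
    unfolding hyperbolic_area_def set_lebesgue_integral_def real_scaleR_def integral_complex_of_real ..
  also have "\<dots> = (\<integral>w. (\<Sum>k = 1..n. V k w) \<partial>lborel)"
  proof (rule integral_cong_AE[OF _ _ AE])
    show "(\<lambda>w. complex_of_real (indicator (inside P) w * (poincare_density w)\<^sup>2)) \<in> borel_measurable lborel"
      using measurable_compose[OF measurable_indicator_density[OF inP] borel_measurable_of_real] by simp
    show "(\<lambda>w. \<Sum>k = 1..n. V k w) \<in> borel_measurable lborel"
      using V(1) by (intro borel_measurable_sum) auto
  qed
  also have "\<dots> = (\<Sum>k = 1..n. 4 * pi / (2 * pi * \<i>) * J k)"
    using V(1,2) by (subst Bochner_Integration.integral_sum) (auto intro!: sum.cong)
  finally have "hyperbolic_area (inside P) = Re (\<Sum>k = 1..n. 4 * pi / (2 * pi * \<i>) * J k)"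
    by (metis Re_complex_of_real)
  \<comment> \<open>\<open>4 * pi / (2 * pi * \<i>) = -2 * \<i>\<close>, and the real part of
    \<open>-2 * \<i> * J k\<close> is \<open>2 * Im (J k)\<close>.\<close>
  also have "\<dots> = (\<Sum>k = 1..n. 2 * Im (J k))"
    by (simp add: Re_divide)
  also have "\<dots> = (\<Sum>k = 1..n. 2 * arctan ((x k * y (k + 1) - y k * x (k + 1)) /
                              (1 - x k * x (k + 1) - y k * y (k + 1))))"
  proof (intro sum.cong refl arg_cong[where f = "(*) 2"])
    fix k assume k: "k \<in> {1..n}"
    show "Im (J k) = arctan ((x k * y (k + 1) - y k * x (k + 1)) / (1 - x k * x (k + 1) - y k * y (k + 1)))"
      \<comment> \<open>For consecutive vertices, \<open>cnj (z k) * z (k + 1)\<close> has the dot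
        product as real part and the cross product as imaginary part.\<close>
      unfolding J_def \<gamma>_def Im_integral_geodesic_arc[OF zk[OF k] zk1[OF k]]
      by (simp add: z_def algebra_simps)
  qed
  finally show ?thesis by (simp add: P_def)
qed

end
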